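(* Let $\mathcal F$ be the family of all sets of the form $C\cup\{c_1,c_2,c_3\}$, where $C$ is a circle in the plane $\mathbb R^2$ and $c_1,c_2,c_3$ are pairwise distinct collinear points in the interior of $C$. The betweenness isomorphism classes of $\mathcal F$ (i.e. the equivalence classes of the relation "betweenness isomorphic" on $\mathcal F$) are exactly the following: (a) $[[v]]$, where $v=(v_1,v_2,v_3)\in\mathbb Z^3$ is balanced with $v_2\ge1$, $v_1\le v_3\le-1$, $\gcd(v)=1$; (b) $\mathbb O:=\{\operatorname{set}(s): s\in\mathcal K_3 \text{ is such that } (0,0,0) \text{ is the only cycle for } s\}$. Each of the classes is listed just once (that is, $[[v]]\ne[[v']]$ for distinct $v,v'$ as in (a), and $\mathbb O\neq[[v]]$ for every $v$ as in (a)).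
   Context: For $a,b\in\mathbb R^2$, $[a,b]$ is the closed segment and $(a,b)=[a,b]\setminus\{a,b\}$ the open segment (empty if $a=b$). A betweenness isomorphism of sets $S,R\subset\mathbb R^2$ is a bijection $f\colon S\to R$ such that for all $a,b,c\in S$: $c\in(a,b)\iff f(c)\in(f(a),f(b))$; $S,R$ are betweenness isomorphic if such a map exists. For $A\subset S\subset\mathbb R^2$, $A$ is collinearly closed in $S$ if $c\in A$ whenever $c\in S$ and there exist distinct $a,b\in A\setminus\{c\}$ such that $a,b,c$ are collinear. $\operatorname{c-hull}_S(A)$ is the smallest set that is collinearly closed in $S$ and contains $A$. $\mathcal K_3$ is the collection of all pairs $s=(C,(c_1,c_2,c_3))$ where $C$ is a circle in the plane and $c_1,c_2,c_3$ are pairwise distinct collinear points from the interior of $C$ such that $c_1<c_2<c_3$ or $c_3<c_2<c_1$ in the natural order on the line through them. Put $\operatorname{set}(s)=C\cup\{c_1,c_2,c_3\}$. The group $G_3$: its elements are all finite sequences $(i_1,\ldots,i_n)$ ($n\ge0$) of elements of $\{1,2,3\}$ that are irreducible, i.e. $i_k\ne i_{k+1}$ for all $1\le k\le n-1$ (the empty sequence $\emptyset$ is included). The product is concatenation followed by reduction (repeatedly deleting pairs of equal adjacent entries); the identity is $\emptyset$. For a point $X$ in the interior of $C$, the reversion $P_X\colon C\to C$ sends $c\in C$ to the unique point $P_X(c)\in C$ with $X\in(c,P_X(c))$. Given $s=(C,(c_1,c_2,c_3))\in\mathcal K_3$, put $R_i=P_{c_i}$; $G_3$ acts on $C$ from the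 right by $c\cdot\emptyset=c$, $c\cdot(i_1,\ldots,i_n)=(R_{i_n}\circ\cdots\circ R_{i_1})(c)$, and $\mathbf S(c)=\{g\in G_3:c\cdot g=c\}$. The signature of $g=(i_1,\ldots,i_n)\in G_3$ is $N(g)=(N(g,1),N(g,2),N(g,3))\in\mathbb Z^3$, where $N(g,i)=\sum_{m\in\{1,\ldots,n\},\,i_m=i}(-1)^{m+1}$ (empty sum $=0$). A vector $v\in\mathbb Z^3$ is a cycle for $s=(C,(c_1,c_2,c_3))\in\mathcal K_3$ if there are $g\in G_3$ and $c\in C\setminus\operatorname{c-hull}_{\operatorname{set}(s)}(\{c_1,c_2,c_3\})$ such that $N(g)=v$ and $g\in\mathbf S(c)$. For $v\in\mathbb Z^3$, $[v]=\{s\in\mathcal K_3: v\text{ is a cycle for }s\}$ and $[[v]]=\{\operatorname{set}(s):s\in[v]\}$. $v=(v_1,v_2,v_3)\in\mathbb Z^3$ is balanced if $v_1+v_2+v_3=0$; for $v\neq(0,0,0)$, $\gcd(v)$ is the greatest common divisor of all entries of $v$. *)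

theory Defs
  imports "HOL-Analysis.Analysis" "HOL-Algebra.Group"
begin

section \<open>Betweenness isomorphisms and collinear hulls\<close>

definition betweenness_isomorphism :: "(real^2 \<Rightarrow> real^2) \<Rightarrow> (real^2) set \<Rightarrow> (real^2) set \<Rightarrow> bool" where
  "betweenness_isomorphism f S R \<longleftrightarrow> bij_betw f S R \<and>
     (\<forall>a\<in>S. \<forall>b\<in>S. \<forall>c\<in>S. c \<in> open_segment a b \<longleftrightarrow> f c \<in> open_segment (f a) (f b))"

definition betweenness_isomorphic :: "(real^2) set \<Rightarrow> (real^2) set \<Rightarrow> bool" where
  "betweenness_isomorphic S R \<longleftrightarrow> (\<exists>f. betweenness_isomorphism f S R)"

definition collinearly_closed :: "(real^2) set \<Rightarrow> (real^2) set \<Rightarrow> bool" where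
  "collinearly_closed S A \<longleftrightarrow> A \<subseteq> S \<and>
     (\<forall>c\<in>S. (\<exists>a\<in>A - {c}. \<exists>b\<in>A - {c}. a \<noteq> b \<and> collinear {a, b, c}) \<longrightarrow> c \<in> A)"

definition c_hull :: "(real^2) set \<Rightarrow> (real^2) set \<Rightarrow> (real^2) set" where
  "c_hull S A = collinearly_closed S hull A"

lemma collinearly_closed_c_hull:
  assumes "A \<subseteq> S"
  shows "collinearly_closed S (c_hull S A)"
proof -
  have "collinearly_closed S S" "A \<subseteq> S"
    using assms by (auto simp: collinearly_closed_def)
  then have "c_hull S A \<subseteq> S"
    unfolding c_hull_def by (simp add: hull_minimal)
  moreover have "c \<in> c_hull S A"
    if c: "c \<in> S" "a \<in> c_hull S A - {c}" "b \<in> c_hull S A - {c}" "a \<noteq> b" "collinear {a, b, c}"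
    for a b c
    unfolding c_hull_def hull_def
  proof (intro InterI, clarify)
    fix T assume T: "collinearly_closed S T" "A \<subseteq> T"
    then have "c_hull S A \<subseteq> T"
      unfolding c_hull_def by (simp add: hull_minimal)
    then have "a \<in> T - {c}" "b \<in> T - {c}"
      using c(2,3) by auto
    then show "c \<in> T"
      using T(1) c(1,4,5) unfolding collinearly_closed_def by meson
  qed
  ultimately show ?thesis
    unfolding collinearly_closed_def by meson
qed


section \<open>Circles with three collinear interior points\<close>

definition circles_with_three_points :: "(real^2) set set" where
  "circles_with_three_points = {sphere z r \<union> {a, b, c} | z r a b c.
     0 < r \<and> {a, b, c} \<subseteq> ball z r \<and> a \<noteq> b \<and> a \<noteq> c \<and> b \<noteq> c \<and> collinear {a, b, c}}"

text \<open>A natural order on a line is given by a parametrization \<open>t \<mapsto> p + t u\<close>; replacing \<open>u\<close>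
  by \<open>- u\<close> exchanges the two alternatives.\<close>

definition in_line_order :: "real^2 \<Rightarrow> real^2 \<Rightarrow> real^2 \<Rightarrow> bool" where
  "in_line_order a b c \<longleftrightarrow> (\<exists>p u s t w. u \<noteq> 0 \<and>
     a = p + s *\<^sub>R u \<and> b = p + t *\<^sub>R u \<and> c = p + w *\<^sub>R u \<and>
     (s < t \<and> t < w \<or> w < t \<and> t < s))"

text \<open>Triples are vectors indexed by the three-element type \<open>3\<close>, whose elements are
  \<open>1\<close>, \<open>2\<close>, \<open>3\<close>.\<close>

definition K3 :: "((real^2) set \<times> ((real^2)^3)) set" where
  "K3 = {(C, c). \<exists>z r. 0 < r \<and> C = sphere z r \<and> {c $ 1, c $ 2, c $ 3} \<subseteq> ball z r \<and>
     c $ 1 \<noteq> c $ 2 \<and> c $ 1 \<noteq> c $ 3 \<and> c $ 2 \<noteq> c $ 3 \<and> collinear {c $ 1, c $ 2, c $ 3} \<and>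
     in_line_order (c $ 1) (c $ 2) (c $ 3)}"

fun set_of :: "(real^2) set \<times> ((real^2)^3) \<Rightarrow> (real^2) set" where
  "set_of (C, c) = C \<union> {c $ 1, c $ 2, c $ 3}"


section \<open>The group \<open>G3\<close> and its action on the circle\<close>

fun cancel_Cons :: "3 \<Rightarrow> 3 list \<Rightarrow> 3 list" where
  "cancel_Cons i [] = [i]"
| "cancel_Cons i (j # w) = (if i = j then w else i # j # w)"

text \<open>The irreducible word obtained by repeatedly deleting pairs of equal adjacent letters.\<close>

definition reduce_word :: "3 list \<Rightarrow> 3 list" where
  "reduce_word w = foldr cancel_Cons w []"

definition G3 :: "3 list monoid" where
  "G3 = \<lparr>carrier = {w. distinct_adj w}, mult = (\<lambda>g h. reduce_word (g @ h)), one = []\<rparr>"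

definition reversion :: "(real^2) set \<Rightarrow> real^2 \<Rightarrow> real^2 \<Rightarrow> real^2" where
  "reversion C X c = (THE d. d \<in> C \<and> X \<in> open_segment c d)"

text \<open>The letters of the word act from left to right.\<close>

fun act :: "(real^2) set \<times> ((real^2)^3) \<Rightarrow> real^2 \<Rightarrow> 3 list \<Rightarrow> real^2" where
  "act (C, c) x g = fold (\<lambda>i. reversion C (c $ i)) g x"

definition stab :: "(real^2) set \<times> ((real^2)^3) \<Rightarrow> real^2 \<Rightarrow> 3 list set" where
  "stab s x = {g \<in> carrier G3. act s x g = x}"

lemma distinct_adj_cancel_Cons: "distinct_adj w \<Longrightarrow> distinct_adj (cancel_Cons i w)"
  by (cases w) (auto simp: distinct_adj_Cons)

lemma cancel_Cons_cancel_Cons: "distinct_adj w \<Longrightarrow> cancel_Cons i (cancel_Cons i w) = w"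
  by (cases w; cases "tl w") (auto simp: distinct_adj_Cons)

lemma distinct_adj_foldr_cancel_Cons:
  "distinct_adj w \<Longrightarrow> distinct_adj (foldr cancel_Cons u w)"
  by (induction u) (auto intro: distinct_adj_cancel_Cons)

lemma foldr_cancel_Cons_cancel_Cons:
  "distinct_adj w \<Longrightarrow>
     foldr cancel_Cons (cancel_Cons i u) w = cancel_Cons i (foldr cancel_Cons u w)"
  by (cases u)
    (auto simp: cancel_Cons_cancel_Cons distinct_adj_foldr_cancel_Cons)

lemma foldr_cancel_Cons_reduce_word:
  "distinct_adj w \<Longrightarrow> foldr cancel_Cons (reduce_word u) w = foldr cancel_Cons u w"
  by (induction u) (auto simp: reduce_word_def foldr_cancel_Cons_cancel_Cons)

lemma distinct_adj_reduce_word: "distinct_adj (reduce_word w)"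
  by (simp add: reduce_word_def distinct_adj_foldr_cancel_Cons)

lemma reduce_word_id: "distinct_adj w \<Longrightarrow> reduce_word w = w"
proof (induction w)
  case (Cons i w)
  then show ?case
    by (cases w) (auto simp: reduce_word_def)
qed (simp add: reduce_word_def)

lemma reduce_word_append: "reduce_word (u @ v) = foldr cancel_Cons u (reduce_word v)"
  by (simp add: reduce_word_def)

lemma foldr_cancel_Cons_rev:
  "distinct_adj w \<Longrightarrow> foldr cancel_Cons (rev u) (foldr cancel_Cons u w) = w"
  by (induction u arbitrary: w)
    (auto simp: cancel_Cons_cancel_Cons distinct_adj_foldr_cancel_Cons)

lemma group_G3: "group G3"
proof (rule groupI)
  fix x y z
  assume "x \<in> carrier G3" "y \<in> carrier G3" "z \<in> carrier G3"
  then have z: "distinct_adj z"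
    by (simp add: G3_def)
  have "reduce_word (reduce_word (x @ y) @ z) = foldr cancel_Cons (x @ y) z"
    unfolding reduce_word_append[of "reduce_word _"] reduce_word_id[OF z]
    by (rule foldr_cancel_Cons_reduce_word[OF z])
  also have "\<dots> = foldr cancel_Cons x (reduce_word (y @ z))"
    unfolding reduce_word_append[of y] reduce_word_id[OF z] by simp
  also have "\<dots> = reduce_word (x @ reduce_word (y @ z))"
    unfolding reduce_word_append[of x] reduce_word_id[OF distinct_adj_reduce_word] ..
  finally show "x \<otimes>\<^bsub>G3\<^esub> y \<otimes>\<^bsub>G3\<^esub> z = x \<otimes>\<^bsub>G3\<^esub> (y \<otimes>\<^bsub>G3\<^esub> z)"
    by (simp add: G3_def)
next
  fix x
  assume x: "x \<in> carrier G3"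
  have "rev x \<in> carrier G3"
    using x by (simp add: G3_def)
  moreover have "rev x \<otimes>\<^bsub>G3\<^esub> x = \<one>\<^bsub>G3\<^esub>"
    using foldr_cancel_Cons_rev[of "[]" x] by (simp add: G3_def reduce_word_def)
  ultimately show "\<exists>y\<in>carrier G3. y \<otimes>\<^bsub>G3\<^esub> x = \<one>\<^bsub>G3\<^esub>"
    by blast
qed (auto simp: G3_def distinct_adj_reduce_word reduce_word_id)


section \<open>Signatures and cycles\<close>

definition signature :: "3 list \<Rightarrow> int^3" where
  "signature g = (\<chi> i. \<Sum>m | m \<in> {1..length g} \<and> g ! (m - 1) = i. (-1) ^ (m + 1))"

fun is_cycle :: "(real^2) set \<times> ((real^2)^3) \<Rightarrow> int^3 \<Rightarrow> bool" where
  "is_cycle (C, c) v \<longleftrightarrow>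
     (\<exists>g \<in> carrier G3. \<exists>x \<in> C - c_hull (set_of (C, c)) {c $ 1, c $ 2, c $ 3}.
        signature g = v \<and> g \<in> stab (C, c) x)"

definition cycle_class :: "int^3 \<Rightarrow> ((real^2) set \<times> ((real^2)^3)) set" where
  "cycle_class v = {s \<in> K3. is_cycle s v}"

definition cycle_sets :: "int^3 \<Rightarrow> (real^2) set set" where
  "cycle_sets v = set_of ` cycle_class v"

definition acyclic_sets :: "(real^2) set set" where
  "acyclic_sets = set_of ` {s \<in> K3. {v. is_cycle s v} = {0}}"

definition balanced :: "int^3 \<Rightarrow> bool" where
  "balanced v \<longleftrightarrow> v $ 1 + v $ 2 + v $ 3 = 0"

definition class_vectors :: "(int^3) set" where
  "class_vectors = {v. balanced v \<and> v $ 2 \<ge> 1 \<and> v $ 1 \<le> v $ 3 \<and> v $ 3 \<le> -1 \<and>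
     Gcd {v $ 1, v $ 2, v $ 3} = 1}"


section \<open>The equivalence relation\<close>

definition betweenness_rel :: "((real^2) set \<times> (real^2) set) set" where
  "betweenness_rel = {(S, R). S \<in> circles_with_three_points \<and> R \<in> circles_with_three_points \<and>
     betweenness_isomorphic S R}"

lemma betweenness_isomorphic_refl: "betweenness_isomorphic S S"
  unfolding betweenness_isomorphic_def betweenness_isomorphism_def
  by (intro exI[of _ id]) auto

lemma betweenness_isomorphic_sym:
  assumes "betweenness_isomorphic S R"
  shows "betweenness_isomorphic R S"
proof -
  obtain f where f: "betweenness_isomorphism f S R"
    using assms by (auto simp: betweenness_isomorphic_def)
  then have bij: "bij_betw f S R"
    by (simp add: betweenness_isomorphism_def)
  have "inv_into S f x \<in> S" "f (inv_into S f x) = x" if "x \<in> R" for x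
    using that bij by (auto simp: bij_betw_def inv_into_into f_inv_into_f)
  with f bij have "betweenness_isomorphism (inv_into S f) R S"
    by (simp add: betweenness_isomorphism_def bij_betw_inv_into)
  then show ?thesis
    by (auto simp: betweenness_isomorphic_def)
qed

lemma betweenness_isomorphic_trans:
  assumes "betweenness_isomorphic S R" "betweenness_isomorphic R T"
  shows "betweenness_isomorphic S T"
proof -
  obtain f g where f: "betweenness_isomorphism f S R" and g: "betweenness_isomorphism g R T"
    using assms by (auto simp: betweenness_isomorphic_def)
  have "f x \<in> R" if "x \<in> S" for x
    using that f by (auto simp: betweenness_isomorphism_def bij_betw_def)
  with f g have "betweenness_isomorphism (g \<circ> f) S T"
    by (auto simp: betweenness_isomorphism_def intro: bij_betw_trans)
  then show ?thesis
    by (auto simp: betweenness_isomorphic_def)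
qed

lemma equiv_betweenness_rel: "equiv circles_with_three_points betweenness_rel"
  unfolding equiv_def refl_on_def sym_def trans_def betweenness_rel_def
  by (auto intro: betweenness_isomorphic_refl betweenness_isomorphic_sym
      betweenness_isomorphic_trans)

end

theory Submission
  imports Defs
begin

text \<open>Let the line through \<open>c\<^sub>1, c\<^sub>2, c\<^sub>3\<close> meet the circle in \<open>p\<close> and \<open>q\<close>, which together with the \<open>c\<^sub>i\<close> form
  the collinear hull. On the two open arcs use the coordinate \<open>u = ln (|x - p| / |x - q|)\<close>. By similar
  triangles the reversion through \<open>c\<^sub>i\<close> exchanges the arcs and acts by \<open>u \<mapsto> \<kappa>\<^sub>i - u\<close>, where
  \<open>\<kappa>\<^sub>i = ln (|c\<^sub>i - p| / |c\<^sub>i - q|)\<close>. Hence the cycles are exactly the balanced \<open>v\<close> with \<open>v \<bullet> \<kappa> = 0\<close>, and they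
  determine the ratio of \<open>\<kappa>\<^sub>2 - \<kappa>\<^sub>1\<close> and \<open>\<kappa>\<^sub>3 - \<kappa>\<^sub>2\<close> if it is rational.

  A betweenness isomorphism maps the \<open>c\<^sub>i\<close> to the \<open>c\<^sub>i\<close> up to reversing their order and commutes with the
  reversions, so it preserves cycles. Conversely, a bijection of the reals that is equivariant for the
  translations by \<open>\<kappa>\<^sub>i - \<kappa>\<^sub>j\<close> induces an isomorphism. For equal rational ratios a linear map will do;
  if both ratios are irrational, the translation groups are free of rank two and act freely with
  continuum many orbits, which can be matched arbitrarily.\<close>

section \<open>Coordinates on the circle\<close>

text \<open>A model of \<open>set_of s\<close>: \<open>Lo\<close> and \<open>Hi\<close> are the two points of the circle on the line, \<open>Mid i\<close>
  is \<open>c\<^sub>i\<close>, and \<open>Arc u e\<close> is the point on the side \<open>e\<close> of the line for which \<open>u\<close> is the logarithm of the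
  ratio of the distances to \<open>Lo\<close> and \<open>Hi\<close>.\<close>

datatype pt = Lo | Hi | Mid 3 | is_Arc: Arc real bool

text \<open>The order along the line, from \<open>Lo\<close> to \<open>Hi\<close>. The value at an
  arc point is a placeholder, guarded by \<open>is_Arc\<close> in \<open>btw\<close>.\<close>

fun pos :: "pt \<Rightarrow> nat" where
  "pos Lo = 0"
| "pos Hi = 4"
| "pos (Mid i) = (if i = 1 then 1 else if i = 2 then 2 else 3)"
| "pos (Arc u e) = 0"

text \<open>\<open>z\<close> lies strictly between \<open>x\<close> and \<open>y\<close>. There are
  two cases only: a chord from one arc to the other through some \<open>Mid i\<close>, or three
  points of the line. A segment from an arc point to a point of the line meets the line in its end
  alone, and no segment has a point of the circle in its interior.\<close>

definition btw :: "(3 \<Rightarrow> real) \<Rightarrow> pt \<Rightarrow> pt \<Rightarrow> pt \<Rightarrow> bool" where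
  "btw \<kappa> x y z \<longleftrightarrow> (case (x, y) of
     (Arc u e, Arc v f) \<Rightarrow> (\<exists>i. z = Mid i \<and> e \<noteq> f \<and> u + v = \<kappa> i)
   | _ \<Rightarrow> \<not> is_Arc x \<and> \<not> is_Arc y \<and> \<not> is_Arc z \<and>
       (pos x < pos z \<and> pos z < pos y \<or> pos y < pos z \<and> pos z < pos x))"

lemma btw_arcs [simp]:
  "btw \<kappa> (Arc u e) (Arc v f) z \<longleftrightarrow> (\<exists>i. z = Mid i \<and> e \<noteq> f \<and> u + v = \<kappa> i)"
  by (simp add: btw_def)

lemma btw_axis [simp]:
  assumes "\<not> is_Arc x \<or> \<not> is_Arc y"
  shows "btw \<kappa> x y z \<longleftrightarrow> \<not> is_Arc x \<and> \<not> is_Arc y \<and> \<not> is_Arc z \<and>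
    (pos x < pos z \<and> pos z < pos y \<or> pos y < pos z \<and> pos z < pos x)"
  using assms by (cases x; cases y; simp add: btw_def)

lemma not_btw_Arc [simp]: "\<not> btw \<kappa> x y (Arc u e)"
  by (simp add: btw_def split: pt.split)

text \<open>Once a chart is given, betweenness in \<open>set_of s\<close> is governed by the three
  increasing numbers \<kappa>.\<close>

definition chart :: "(real^2) set \<times> ((real^2)^3) \<Rightarrow> (3 \<Rightarrow> real) \<Rightarrow> (pt \<Rightarrow> real^2) \<Rightarrow> bool" where
  "chart s \<kappa> \<Gamma> \<longleftrightarrow> \<kappa> 1 < \<kappa> 2 \<and> \<kappa> 2 < \<kappa> 3 \<and> bij_betw \<Gamma> UNIV (set_of s) \<and>
     (\<forall>i. \<Gamma> (Mid i) = snd s $ i) \<and>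
     (\<forall>x y z. \<Gamma> z \<in> open_segment (\<Gamma> x) (\<Gamma> y) \<longleftrightarrow> btw \<kappa> x y z)"

text \<open>The line is \<open>b = 0\<close> in the orthonormal coordinates \<open>P a b\<close> below, whose origin is the foot of
  the perpendicular from the centre \<open>z\<close>; \<open>h\<close> is half the length of the chord.\<close>

locale chord =
  fixes z k n :: "real^2" and d r h :: real
  assumes k1: "k \<bullet> k = 1" and n1: "n \<bullet> n = 1" and kn: "k \<bullet> n = 0"
    and h: "0 < h" and r: "0 < r" and hdr: "h\<^sup>2 + d\<^sup>2 = r\<^sup>2"
begin

section \<open>Cartesian coordinates adapted to the chord\<close>

definition P :: "real \<Rightarrow> real \<Rightarrow> real^2" where
  "P a b = z + a *\<^sub>R k + (b + d) *\<^sub>R n"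

lemma P_inner: "(P a b - z) \<bullet> k = a" "(P a b - z) \<bullet> n = b + d"
  by (auto simp: P_def inner_add_left inner_add_right k1 n1 kn inner_commute[of n k])

lemma P_eq_iff [simp]: "P a b = P a' b' \<longleftrightarrow> a = a' \<and> b = b'"
  by (metis P_inner add_right_cancel)

lemma norm_P: "(norm (P a b - z))\<^sup>2 = a\<^sup>2 + (b + d)\<^sup>2"
proof -
  have "P a b - z = a *\<^sub>R k + (b + d) *\<^sub>R n" by (simp add: P_def)
  then show ?thesis
    by (simp add: power2_norm_eq_inner inner_add_left inner_add_right k1 n1 kn inner_commute[of n k])
      (simp add: power2_eq_square)
qed

lemma dist_P: "dist z (P a b) = sqrt (a\<^sup>2 + (b + d)\<^sup>2)"
  by (metis dist_commute dist_norm norm_P norm_ge_zero real_sqrt_unique)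

text \<open>The centre is \<open>P 0 (- d)\<close>, and \<open>hdr\<close> removes \<open>r\<close>
  from the equation of the circle. The line \<open>b = 0\<close> is met at \<open>a = h\<close> and
  \<open>a = - h\<close>.\<close>

lemma P_sphere: "P a b \<in> sphere z r \<longleftrightarrow> a\<^sup>2 + b\<^sup>2 + 2 * b * d = h\<^sup>2"
proof -
  have "P a b \<in> sphere z r \<longleftrightarrow> a\<^sup>2 + (b + d)\<^sup>2 = r\<^sup>2"
    using r by (simp add: dist_P real_sqrt_eq_iff[symmetric, of _ "r\<^sup>2"] del: real_sqrt_eq_iff)
  then show ?thesis using hdr by (auto simp: power2_eq_square algebra_simps)
qed

lemma P_ball: "P a b \<in> ball z r \<longleftrightarrow> a\<^sup>2 + b\<^sup>2 + 2 * b * d < h\<^sup>2"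
proof -
  have "P a b \<in> ball z r \<longleftrightarrow> a\<^sup>2 + (b + d)\<^sup>2 < r\<^sup>2"
    using r by (simp add: dist_P real_sqrt_less_iff[symmetric, of _ "r\<^sup>2"] del: real_sqrt_less_iff)
  then show ?thesis using hdr by (auto simp: power2_eq_square algebra_simps)
qed

lemma P_surj: "\<exists>a b. x = P a b"
proof -
  define y where "y = x - z"
  have "k$1 * k$1 + k$2 * k$2 = 1" "n$1 * n$1 + n$2 * n$2 = 1" "k$1 * n$1 + k$2 * n$2 = 0"
    using k1 n1 kn by (simp_all add: inner_vec_def sum_2)
  note a = this
  \<comment> \<open>An orthogonal matrix has orthonormal rows as well as columns. The next three
    identities amount to this for the columns \<open>k\<close> and \<open>n\<close>, and yield the
    expansion of \<open>y\<close> in this basis.\<close>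
  have b: "n$1 * n$1 = k$2 * k$2" 
    using a by algebra
  have c: "n$2 * n$2 = k$1 * k$1"
    using a by algebra
  have "n$1 * n$2 = - k$1 * k$2"
    using a by algebra
  then have 1: "y$1 = (y \<bullet> k) * k$1 + (y \<bullet> n) * n$1" "y$2 = (y \<bullet> k) * k$2 + (y \<bullet> n) * n$2"
    using a b c unfolding inner_vec_def sum_2 inner_real_def by algebra+
  have "x = P (y \<bullet> k) ((y \<bullet> n) - d)"
    using 1 by (simp add: P_def y_def vec_eq_iff forall_2 algebra_simps)
  then show ?thesis by blast
qed

lemma P_open_segment:
  "P x y \<in> open_segment (P a b) (P a' b') \<longleftrightarrow> (a, b) \<noteq> (a', b') \<and>
     (\<exists>t. 0 < t \<and> t < 1 \<and> x = (1 - t) * a + t * a' \<and> y = (1 - t) * b + t * b')"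
proof -
  have "(1 - t) *\<^sub>R P a b + t *\<^sub>R P a' b' = P ((1 - t) * a + t * a') ((1 - t) * b + t * b')" for t
    by (simp add: P_def vec_eq_iff algebra_simps)
  then show ?thesis by (auto simp: in_segment)
qed

lemma P_axis_segment:
  "P x 0 \<in> open_segment (P a 0) (P a' 0) \<longleftrightarrow> a < x \<and> x < a' \<or> a' < x \<and> x < a"
proof -
  have *: "\<exists>t. 0 < t \<and> t < 1 \<and> x = (1 - t) * a + t * a'" if "a < x \<and> x < a' \<or> a' < x \<and> x < a"
    using that by (intro exI[of _ "(x - a) / (a' - a)"]) (auto simp: field_simps)
  have "a < (1 - t) * a + t * a' \<and> (1 - t) * a + t * a' < a'" if "0 < t" "t < 1" "a < a'" for t a a' :: real
  proof -
    have "0 < t * (a' - a)" "0 < (1 - t) * (a' - a)" using that by auto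
    then show ?thesis by (auto simp: algebra_simps)
  qed
  note 1 = this
  have 2: "a < (1 - t) * a + t * a' \<and> (1 - t) * a + t * a' < a' \<or> a' < (1 - t) * a + t * a' \<and> (1 - t) * a + t * a' < a"
    if "0 < t" "t < 1" "a \<noteq> a'" for t
    using 1[of t a a'] 1[of "1 - t" a' a] that by (cases a a' rule: linorder_cases) (auto simp: add.commute)
  show ?thesis
  proof
    assume "P x 0 \<in> open_segment (P a 0) (P a' 0)"
    then obtain t where "a \<noteq> a'" "0 < t" "t < 1" "x = (1 - t) * a + t * a'"
      by (auto simp: P_open_segment)
    then show "a < x \<and> x < a' \<or> a' < x \<and> x < a" using 2 by simp
  next
    assume x: "a < x \<and> x < a' \<or> a' < x \<and> x < a"
    then obtain t where "0 < t" "t < 1" "x = (1 - t) * a + t * a'" using * by blast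
    moreover have "a \<noteq> a'" using x by auto
    ultimately show "P x 0 \<in> open_segment (P a 0) (P a' 0)"
      unfolding P_open_segment by (intro conjI exI[of _ t]) auto
  qed
qed

text \<open>The segment crosses the line iff the ordinates have opposite signs, at the parameter
  \<open>b / (b - b')\<close>. The equation for \<open>s\<close> is the abscissa of the crossing
  with denominators cleared.\<close>

lemma P_chord_segment:
  assumes "b \<noteq> 0" "b' \<noteq> 0"
  shows "P s 0 \<in> open_segment (P a b) (P a' b') \<longleftrightarrow> b * b' < 0 \<and> s * (b' - b) = a * b' - a' * b"
proof
  assume "P s 0 \<in> open_segment (P a b) (P a' b')"
  then obtain t where t: "0 < t" "t < 1" "s = (1 - t) * a + t * a'" "0 = (1 - t) * b + t * b'"
    unfolding P_open_segment by blast
  have "t * (b * b') = - ((1 - t) * b\<^sup>2)"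
    using t(4) by algebra
  moreover have "(1 - t) * b\<^sup>2 > 0" using t assms by simp
  ultimately have "t * (b * b') < 0" by simp
  then have "b * b' < 0" using t(1) by (simp add: mult_less_0_iff)
  moreover have "s * (b' - b) = a * b' - a' * b" using t(3,4) by algebra
  ultimately show "b * b' < 0 \<and> s * (b' - b) = a * b' - a' * b" ..
next
  assume *: "b * b' < 0 \<and> s * (b' - b) = a * b' - a' * b"
  then have bb: "b > 0 \<and> b' < 0 \<or> b < 0 \<and> b' > 0"
    by (simp add: mult_less_0_iff)
  then have "0 < b / (b - b') \<and> b / (b - b') < 1"
    by (auto simp: field_simps)
  moreover have "s = (1 - b / (b - b')) * a + b / (b - b') * a'"
    "0 = (1 - b / (b - b')) * b + b / (b - b') * b'"
    using bb * by (auto simp: field_simps)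
  ultimately show "P s 0 \<in> open_segment (P a b) (P a' b')"
    unfolding P_open_segment using bb by (auto intro!: exI[of _ "b / (b - b')"])
qed

text \<open>\<open>Q t\<close> is the point of the circle with \<open>\<bar>t\<bar> / r\<close> as ratio of its distances to \<open>P (- h) 0\<close> and
  \<open>P h 0\<close>, on the side given by the sign of \<open>t\<close>. In this parameter every reversion through a point of
  the line is a map \<open>t \<mapsto> - k / t\<close>.\<close>

definition D :: "real \<Rightarrow> real" where "D t = t\<^sup>2 + 2 * t * d + r\<^sup>2"

lemma D_pos: "D t > 0"
proof -
  have "D t = (t + d)\<^sup>2 + h\<^sup>2" using hdr by (simp add: D_def power2_eq_square algebra_simps)
  then show ?thesis using h by (simp add: add_nonneg_pos)
qed

definition Q :: "real \<Rightarrow> real^2" where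
  "Q t = P (h * (t\<^sup>2 - r\<^sup>2) / D t) (2 * h\<^sup>2 * t / D t)"

lemma Q_sphere: "Q t \<in> sphere z r"
proof -
  have D: "D t \<noteq> 0" using D_pos[of t] by simp
  have "(h * (t\<^sup>2 - r\<^sup>2))\<^sup>2 + (2 * h\<^sup>2 * t)\<^sup>2 + 2 * (2 * h\<^sup>2 * t) * d * D t = h\<^sup>2 * (D t)\<^sup>2"
    using hdr unfolding D_def by algebra
  then show ?thesis
    unfolding Q_def P_sphere using D by (simp add: field_simps power2_eq_square)
qed

lemma Q_inj: "Q t = Q t' \<longleftrightarrow> t = t'"
proof
  assume "Q t = Q t'"
  then have 1: "h * (t\<^sup>2 - r\<^sup>2) / D t = h * (t'\<^sup>2 - r\<^sup>2) / D t'" "2 * h\<^sup>2 * t / D t = 2 * h\<^sup>2 * t' / D t'"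
    by (auto simp: Q_def)
  \<comment> \<open>For the coordinates \<open>a\<close>, \<open>b\<close> of \<open>Q t\<close>
    this says \<open>h\<^sup>2 + h * a - b * d = b * t\<close>, so the point determines
    \<open>t\<close> unless \<open>b = 0\<close>, which means \<open>t = 0\<close>.\<close>
  have t: "h\<^sup>2 + h * (h * (t\<^sup>2 - r\<^sup>2) / D t) - 2 * h\<^sup>2 * t / D t * d = 2 * h\<^sup>2 * t / D t * t" for t
    using D_pos[of t] by (simp add: field_simps) (simp add: D_def power2_eq_square algebra_simps)
  show "t = t'"
  proof (cases "t = 0")
    case True
    with 1 h D_pos[of t'] show ?thesis by (auto)
  next
    case False
    then have "2 * h\<^sup>2 * t / D t \<noteq> 0" using h D_pos[of t] by auto
    with t[of t] t[of t'] 1 show ?thesis by auto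
  qed
qed auto

lemma Q_surj:
  assumes "P a b \<in> sphere z r" "b \<noteq> 0"
  shows "\<exists>t. t \<noteq> 0 \<and> P a b = Q t"
proof -
  have *: "a\<^sup>2 + b\<^sup>2 + 2 * b * d = h\<^sup>2" using assms P_sphere by blast
  \<comment> \<open>The relation \<open>h\<^sup>2 + h * a - b * d = b * t\<close> is solved for
    \<open>t\<close>. Its left side \<open>m\<close> is half the squared distance from the point to
    \<open>P (- h) 0\<close>, hence positive.\<close>
  define m where "m = h\<^sup>2 + h * a - b * d"
  have m2: "(a + h)\<^sup>2 + b\<^sup>2 = 2 * m" using * by (simp add: m_def power2_eq_square algebra_simps)
  then have m0: "m > 0" using assms(2) by (smt (verit) zero_le_power2 zero_less_power2)
  define t where "t = m / b"
  have t: "t * b = m" "t \<noteq> 0" using assms(2) m0 by (auto simp: t_def)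
  have "b\<^sup>2 * (b * D t) = b\<^sup>2 * (2 * h\<^sup>2 * t)"
    using t(1) * hdr unfolding D_def m_def by algebra
  then have 1: "b * D t = 2 * h\<^sup>2 * t" using assms(2) by simp
  have "b\<^sup>2 * (a * D t) = b\<^sup>2 * (h * (t\<^sup>2 - r\<^sup>2))"
    using t(1) * hdr 1 unfolding D_def m_def by algebra
  then have 2: "a * D t = h * (t\<^sup>2 - r\<^sup>2)" using assms(2) by simp
  have "P a b = Q t"
    unfolding Q_def P_eq_iff using 1 2 D_pos[of t] by (simp add: field_simps)
  with t show ?thesis by blast
qed

text \<open>After substitution in \<open>P_chord_segment\<close> the nonzero factor
  \<open>t - t'\<close> cancels, and only the product \<open>t * t'\<close> remains. For
  \<bar>s\<bar> < h the reversion is thus \<open>t \<mapsto> - k / t\<close> with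
  \<open>k = r\<^sup>2 * (h + s) / (h - s)\<close>.\<close>

lemma Q_chord:
  assumes "t \<noteq> 0" "t' \<noteq> 0"
  shows "P s 0 \<in> open_segment (Q t) (Q t') \<longleftrightarrow> t * t' < 0 \<and> t * t' * (h - s) = - r\<^sup>2 * (h + s)"
proof -
  have D: "D t > 0" "D t' > 0" by (rule D_pos)+
  then have *: "2 * h\<^sup>2 * t / D t \<noteq> 0" "2 * h\<^sup>2 * t' / D t' \<noteq> 0" using h assms by auto
  have "(2 * h\<^sup>2 * t / D t) * (2 * h\<^sup>2 * t' / D t') = (2 * h\<^sup>2)\<^sup>2 / (D t * D t') * (t * t')"
    by (simp add: field_simps power2_eq_square)
  moreover have "(2 * h\<^sup>2)\<^sup>2 / (D t * D t') > 0" using h D by simp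
  ultimately have 1: "(2 * h\<^sup>2 * t / D t) * (2 * h\<^sup>2 * t' / D t') < 0 \<longleftrightarrow> t * t' < 0"
    by (metis mult_less_0_iff not_less_iff_gr_or_eq)
  \<comment> \<open>Named inverses of the denominators turn the identity into a polynomial
    one.\<close>
  define i j where "i = inverse (D t)" and "j = inverse (D t')"
  have ij: "i * D t = 1" "j * D t' = 1" "i > 0" "j > 0"
    using D by (simp_all add: i_def j_def)
  have E: "s * (2 * h\<^sup>2 * t' * j - 2 * h\<^sup>2 * t * i) -
      (h * (t\<^sup>2 - r\<^sup>2) * i * (2 * h\<^sup>2 * t' * j) - h * (t'\<^sup>2 - r\<^sup>2) * j * (2 * h\<^sup>2 * t * i)) =
      2 * h\<^sup>2 * i * j * (s * (t' * D t - t * D t') - h * ((t\<^sup>2 - r\<^sup>2) * t' - (t'\<^sup>2 - r\<^sup>2) * t))"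
    using ij(1,2) by algebra
  have "s * (2 * h\<^sup>2 * t' * j - 2 * h\<^sup>2 * t * i) =
      h * (t\<^sup>2 - r\<^sup>2) * i * (2 * h\<^sup>2 * t' * j) - h * (t'\<^sup>2 - r\<^sup>2) * j * (2 * h\<^sup>2 * t * i) \<longleftrightarrow>
      2 * h\<^sup>2 * i * j * (s * (t' * D t - t * D t') - h * ((t\<^sup>2 - r\<^sup>2) * t' - (t'\<^sup>2 - r\<^sup>2) * t)) = 0"
    by (subst eq_iff_diff_eq_0, subst E, rule refl)
  also have "\<dots> \<longleftrightarrow> s * (t' * D t - t * D t') = h * ((t\<^sup>2 - r\<^sup>2) * t' - (t'\<^sup>2 - r\<^sup>2) * t)"
    using h ij(3,4) by simp
  also have "t' * D t - t * D t' = (t - t') * (t * t' - r\<^sup>2)"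
    unfolding D_def by algebra
  also have "(t\<^sup>2 - r\<^sup>2) * t' - (t'\<^sup>2 - r\<^sup>2) * t = (t - t') * (t * t' + r\<^sup>2)"
    by algebra
  finally have 2: "s * (2 * h\<^sup>2 * t' / D t' - 2 * h\<^sup>2 * t / D t) =
      h * (t\<^sup>2 - r\<^sup>2) / D t * (2 * h\<^sup>2 * t' / D t') - h * (t'\<^sup>2 - r\<^sup>2) / D t' * (2 * h\<^sup>2 * t / D t) \<longleftrightarrow>
     (t - t') * (s * (t * t' - r\<^sup>2)) = (t - t') * (h * (t * t' + r\<^sup>2))"
    by (simp only: i_def j_def divide_inverse mult.left_commute)
  have 3: "(t - t') * (s * (t * t' - r\<^sup>2)) = (t - t') * (h * (t * t' + r\<^sup>2)) \<longleftrightarrow> t * t' * (h - s) = - r\<^sup>2 * (h + s)"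
    if "t * t' < 0"
  proof -
    have "t \<noteq> t'" using that by (auto simp: mult_less_0_iff)
    then have "(t - t') * (s * (t * t' - r\<^sup>2)) = (t - t') * (h * (t * t' + r\<^sup>2)) \<longleftrightarrow>
        s * (t * t' - r\<^sup>2) = h * (t * t' + r\<^sup>2)"
      by simp
    then show ?thesis by (auto simp: algebra_simps)
  qed
  show ?thesis
    unfolding Q_def P_chord_segment[OF *] 1 2 using 3 by blast
qed

section \<open>Logarithmic coordinates on the arcs and the chart\<close>

definition sg :: "bool \<Rightarrow> real" where "sg \<epsilon> = (if \<epsilon> then 1 else - 1)"

text \<open>Logarithms turn the prescribed product in \<open>Q_chord\<close> into a prescribed
  sum.\<close>

lemma Q_arc:
  assumes "\<bar>s\<bar> < h"
  shows "P s 0 \<in> open_segment (Q (sg e * (r * exp u))) (Q (sg f * (r * exp v))) \<longleftrightarrow>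
    e \<noteq> f \<and> u + v = ln ((h + s) / (h - s))"
proof -
  have 0: "sg e * (r * exp u) \<noteq> 0" for e u using r by (auto simp: sg_def)
  have 1: "(sg e * (r * exp u)) * (sg f * (r * exp v)) = sg e * sg f * (r\<^sup>2 * exp (u + v))"
    by (simp add: exp_add power2_eq_square)
  have 2: "(sg e * (r * exp u)) * (sg f * (r * exp v)) < 0 \<longleftrightarrow> e \<noteq> f"
    unfolding 1 using r by (cases e; cases f; simp add: sg_def mult_less_0_iff not_less)
  have hs: "h + s > 0" "h - s > 0" using assms by auto
  have 3: "(sg e * (r * exp u)) * (sg f * (r * exp v)) * (h - s) = - r\<^sup>2 * (h + s) \<longleftrightarrow> u + v = ln ((h + s) / (h - s))"
    if "e \<noteq> f"
  proof -
    have "sg e * sg f = -1" using that by (auto simp: sg_def)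
    then have "?thesis \<longleftrightarrow> ((exp (u + v) * (h - s) = h + s) \<longleftrightarrow> u + v = ln ((h + s) / (h - s)))"
      unfolding 1 using r by (simp add: mult.assoc)
    moreover have "(exp (u + v) * (h - s) = h + s) \<longleftrightarrow> exp (u + v) = (h + s) / (h - s)"
      using hs by (simp add: field_simps)
    moreover have "exp (u + v) = (h + s) / (h - s) \<longleftrightarrow> u + v = ln ((h + s) / (h - s))"
      using hs by (metis divide_pos_pos exp_ln ln_exp)
    ultimately show ?thesis by blast
  qed
  show ?thesis unfolding Q_chord[OF 0 0] 2 using 3 by blast
qed

text \<open>The modulus \<open>r * exp u\<close> of the parameter of \<open>Q\<close> makes
  \<open>u\<close> the logarithm of the ratio of the distances to \<open>Lo\<close> and
  \<open>Hi\<close>.\<close>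

fun point :: "(3 \<Rightarrow> real) \<Rightarrow> pt \<Rightarrow> real^2" where
  "point s Lo = P (-h) 0"
| "point s Hi = P h 0"
| "point s (Mid i) = P (s i) 0"
| "point s (Arc u e) = Q (sg e * (r * exp u))"

text \<open>By strict convexity, an inner point of a segment is closer to the centre than one of the
  ends. Hence no point of the circle lies between two points of the closed disc.\<close>

lemma segment_in_ball:
  assumes "x \<in> cball z r" "y \<in> cball z r" "w \<in> open_segment x y"
  shows "w \<in> ball z r"
  using dist_decreases_open_segment[OF assms(3), of z] assms(1,2) by auto

text \<open>Betweenness is checked by the kind of the ends. Two points of the line: compare
  abscissas. One: the segment meets the line only there. None: \<open>Q_arc\<close>. The numbers
  \<open>(h + s i) / (h - s i)\<close> are the distance ratios of the three inner points.\<close>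

lemma chart_point:
  assumes s: "s 1 < s 2" "s 2 < s 3" "\<And>i. \<bar>s i\<bar> < h" and c: "\<And>i. c $ i = P (s i) 0"
  shows "chart (sphere z r, c) (\<lambda>i. ln ((h + s i) / (h - s i))) (point s)" (is "chart _ ?\<kappa> _")
proof -
  have mid: "P (s i) 0 \<in> ball z r" for i
    using s(3)[of i] h by (simp add: P_ball del: mem_ball) (metis abs_le_square_iff abs_of_pos leD not_le)
  have lohi: "P (-h) 0 \<in> sphere z r" "P h 0 \<in> sphere z r"
    by (simp_all add: P_sphere del: mem_sphere)
  have cball: "point s x \<in> cball z r" for x
  proof (cases x)
    case (Mid i) then show ?thesis using mid[of i] by simp
  next
    case (Arc u \<epsilon>) then show ?thesis using Q_sphere[of "sg \<epsilon> * (r * exp u)"] by simp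
  qed (use lohi in auto)
  have sg0: "sg e * (r * exp u) \<noteq> 0" for e u using r by (auto simp: sg_def)
  have QP: "\<exists>a b. b \<noteq> 0 \<and> Q t = P a b" if "t \<noteq> 0" for t
    using that h D_pos[of t] unfolding Q_def by force
  have sginj: "sg e * (r * exp u) = sg f * (r * exp v) \<longleftrightarrow> e = f \<and> u = v" for e f u v
  proof -
    have "r * exp u > 0" "r * exp v > 0" using r by auto
    then show ?thesis by (cases e; cases f; simp add: sg_def) (use r in auto)
  qed
  \<comment> \<open>Abscissas of the points of the line; the value 0 at arc points is a
    placeholder.\<close>
  define xc where "xc x = (case x of Lo \<Rightarrow> - h | Hi \<Rightarrow> h | Mid i \<Rightarrow> s i | _ \<Rightarrow> 0)" for x
  define ax where "ax x = (case x of Arc u e \<Rightarrow> False | _ \<Rightarrow> True)" for x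
  have axP: "point s x = P (xc x) 0" if "ax x" for x
    using that by (cases x) (auto simp: xc_def ax_def)
  have sh: "- h < s i" "s i < h" for i using s(3)[of i] by auto
  have pos_mid: "0 < pos (Mid i)" "pos (Mid i) < 4" "pos (Mid i) \<noteq> 0" "pos (Mid i) \<noteq> 4" for i
    by auto
  have lt_mid: "s i < s j \<longleftrightarrow> pos (Mid i) < pos (Mid j)" for i j
    using exhaust_3[of i] exhaust_3[of j] s(1,2) by auto
  have eq_mid: "pos (Mid i) = pos (Mid j) \<longleftrightarrow> i = j" for i j
    using exhaust_3[of i] exhaust_3[of j] by auto
  have nsh: "\<not> h < s i" "\<not> s i < - h" "\<not> h < - h" for i
    using sh[of i] h by auto
  have axlt: "xc x < xc y \<longleftrightarrow> pos x < pos y" if "ax x" "ax y" for x y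
    using that h
    by (cases x; cases y)
      (simp_all add: xc_def ax_def sh nsh lt_mid pos_mid not_less less_imp_le del: pos.simps(3))
  have poseq: "pos x = pos y \<longleftrightarrow> x = y" if "ax x" "ax y" for x y
    using that by (cases x; cases y) (simp_all add: ax_def pos_mid pos_mid(3,4)[symmetric] eq_mid del: pos.simps(3))
  have axeq: "xc x = xc y \<longleftrightarrow> x = y" if "ax x" "ax y" for x y
    using axlt[OF that] axlt[OF that(2,1)] poseq[OF that] by (metis nat_neq_iff less_irrefl neqE)
  have nax: "\<exists>a b. b \<noteq> 0 \<and> point s x = P a b" if "\<not> ax x" for x
    using that QP[OF sg0] by (cases x) (auto simp: ax_def)
  have "inj (point s)"
  proof (rule injI)
    fix x y assume xy: "point s x = point s y"
    show "x = y"
    proof (cases "ax x"; cases "ax y")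
      assume "ax x" "ax y" then show ?thesis using xy axP axeq by auto
    next
      assume "ax x" "\<not> ax y" then show ?thesis using xy axP nax[of y] by auto
    next
      assume "\<not> ax x" "ax y" then show ?thesis using xy axP nax[of x] by auto
    next
      assume "\<not> ax x" "\<not> ax y" then show ?thesis using xy Q_inj sginj
        by (cases x; cases y) (auto simp: ax_def)
    qed
  qed
  moreover have "range (point s) = set_of (sphere z r, c)"
  proof
    show "range (point s) \<subseteq> set_of (sphere z r, c)"
    proof clarify
      fix x show "point s x \<in> set_of (sphere z r, c)"
        using lohi Q_sphere c by (cases x) (auto, metis exhaust_3)
    qed
    show "set_of (sphere z r, c) \<subseteq> range (point s)"
    proof
      fix x assume x: "x \<in> set_of (sphere z r, c)"
      show "x \<in> range (point s)"
      proof (cases "x \<in> sphere z r")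
        case False
        then obtain i where "x = c $ i" using x by auto
        then have "x = point s (Mid i)" using c by simp
        then show ?thesis by blast
      next
        case True
        obtain a b where ab: "x = P a b" using P_surj by blast
        show ?thesis
        proof (cases "b = 0")
          case True
          with ab \<open>x \<in> sphere z r\<close> have "a\<^sup>2 = h\<^sup>2" using P_sphere[of a b] by simp
          then have "a = h \<or> a = -h" by (simp add: power2_eq_iff)
          then have "x = point s Hi \<or> x = point s Lo" using ab True by auto
          then show ?thesis by blast
        next
          case False
          then obtain t where t: "t \<noteq> 0" "x = Q t" using Q_surj True ab by metis
          \<comment> \<open>The sign of \<open>t\<close> gives the side, its modulus the
            coordinate.\<close>
          have "t = sg (t > 0) * (r * exp (ln (\<bar>t\<bar> / r)))"
            using t r by (auto simp: sg_def)
          then have "x = point s (Arc (ln (\<bar>t\<bar> / r)) (t > 0))" using t by simp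
          then show ?thesis by blast
        qed
      qed
    qed
  qed
  ultimately have bij: "bij_betw (point s) UNIV (set_of (sphere z r, c))"
    by (simp add: bij_betw_def)
  have out: "\<not> (\<exists>i. w = Mid i) \<Longrightarrow> point s w \<notin> open_segment (point s x) (point s y)" for x y w
    using segment_in_ball[OF cball[of x] cball[of y]] lohi Q_sphere by (cases w) fastforce+
  have mixed: "P a 0 \<notin> open_segment (P a1 0) (point s y)" "P a 0 \<notin> open_segment (point s y) (P a1 0)"
    if "\<not> ax y" for a a1 y
  proof -
    obtain a2 b2 where "b2 \<noteq> 0" "point s y = P a2 b2" using nax \<open>\<not> ax y\<close> by blast
    then show "P a 0 \<notin> open_segment (P a1 0) (point s y)" by (auto simp: P_open_segment)
    then show "P a 0 \<notin> open_segment (point s y) (P a1 0)" by (simp add: open_segment_commute)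
  qed
  have main: "point s (Mid i) \<in> open_segment (point s x) (point s y) \<longleftrightarrow> btw ?\<kappa> x y (Mid i)" for x y i
  proof (cases "ax x"; cases "ax y")
    assume a: "ax x" "ax y"
    have m: "ax (Mid i)" by (simp add: ax_def)
    have "btw ?\<kappa> x y (Mid i) \<longleftrightarrow> pos x < pos (Mid i) \<and> pos (Mid i) < pos y \<or> pos y < pos (Mid i) \<and> pos (Mid i) < pos x"
      using a by (cases x; cases y) (auto simp: ax_def)
    then show ?thesis unfolding axP[OF a(1)] axP[OF a(2)] axP[OF m] P_axis_segment
      using axlt a m by blast
  next
    assume a: "ax x" "\<not> ax y"
    have "\<not> btw ?\<kappa> x y (Mid i)" using a by (cases x; cases y) (auto simp: ax_def)
    then show ?thesis using mixed(1)[OF a(2)] axP[OF a(1)] by simp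
  next
    assume a: "\<not> ax x" "ax y"
    have "\<not> btw ?\<kappa> x y (Mid i)" using a by (cases x; cases y) (auto simp: ax_def)
    then show ?thesis using mixed(2)[OF a(1)] axP[OF a(2)] by simp
  next
    assume a: "\<not> ax x" "\<not> ax y"
    then obtain u e v f where "x = Arc u e" "y = Arc v f" by (cases x; cases y) (auto simp: ax_def)
    then show ?thesis using Q_arc[OF s(3)[of i]] by simp
  qed
  have "point s w \<in> open_segment (point s x) (point s y) \<longleftrightarrow> btw ?\<kappa> x y w" for x y w
  proof (cases "\<exists>i. w = Mid i")
    case False
    have "\<not> btw ?\<kappa> x y w" using False by (cases x; cases y; cases w) auto
    then show ?thesis using out[OF False] by blast
  qed (use main in blast)
  moreover have "?\<kappa> i < ?\<kappa> j" if "s i < s j" for i j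
  proof -
    have *: "0 < h + s i" "0 < h - s i" "0 < h + s j" "0 < h - s j" using sh[of i] sh[of j] by auto
    have "(h + s i) / (h - s i) < (h + s j) / (h - s j)"
      by (rule frac_less2) (use * that in auto)
    then show ?thesis using * by simp
  qed
  ultimately show ?thesis unfolding chart_def using bij s c by auto
qed

end

section \<open>Existence of charts\<close>

lemma planar_frame:
  fixes u :: "real^2"
  assumes "u \<noteq> 0"
  obtains k n where "k \<bullet> k = 1" "n \<bullet> n = 1" "k \<bullet> n = 0" "u = norm u *\<^sub>R k"
    "\<And>y. y = (y \<bullet> k) *\<^sub>R k + (y \<bullet> n) *\<^sub>R n"
proof
  define k where "k = u /\<^sub>R norm u"
  \<comment> \<open>This is \<open>k\<close> turned by a right angle.\<close>
  define n :: "real^2" where "n = (\<chi> i. if i = 1 then - k $ 2 else k $ 1)"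
  have n: "n $ 1 = - k $ 2" "n $ 2 = k $ 1" by (simp_all add: n_def)
  have "norm k = 1" using assms by (simp add: k_def)
  then show kk: "k \<bullet> k = 1" by (simp add: norm_eq_1)
  then have k: "k $ 1 * k $ 1 + k $ 2 * k $ 2 = 1" by (simp add: inner_vec_def sum_2)
  show "n \<bullet> n = 1" using k by (simp add: inner_vec_def sum_2 n)
  show "k \<bullet> n = 0" by (simp add: inner_vec_def sum_2 n)
  show "u = norm u *\<^sub>R k" using assms by (simp add: k_def)
  have *: "y $ 1 = (y \<bullet> k) * k $ 1 + (y \<bullet> n) * n $ 1" "y $ 2 = (y \<bullet> k) * k $ 2 + (y \<bullet> n) * n $ 2" for y :: "real^2"
    using k unfolding inner_vec_def sum_2 n inner_real_def by algebra+
  show "y = (y \<bullet> k) *\<^sub>R k + (y \<bullet> n) *\<^sub>R n" for y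
    using *[of y] by (simp add: vec_eq_iff forall_2)
qed

lemma in_line_orderE:
  assumes "in_line_order a b c"
  obtains p u s t w where "u \<noteq> 0" "a = p + s *\<^sub>R u" "b = p + t *\<^sub>R u" "c = p + w *\<^sub>R u" "s < t" "t < w"
proof -
  obtain p u s t w where *: "u \<noteq> 0" "a = p + s *\<^sub>R u" "b = p + t *\<^sub>R u" "c = p + w *\<^sub>R u"
    "s < t \<and> t < w \<or> w < t \<and> t < s"
    using assms unfolding in_line_order_def by blast
  show thesis
  proof (cases "s < t")
    case True
    with * that show ?thesis by auto
  next
    case False
    with * that[of "-u" p "-s" "-t" "-w"] show ?thesis by auto
  qed
qed

lemma chart_exists:
  assumes "s \<in> K3"
  obtains \<kappa> \<Gamma> where "chart s \<kappa> \<Gamma>"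
proof -
  obtain C c where sC: "s = (C, c)" by (cases s)
  then obtain z r where r: "0 < r" and C: "C = sphere z r"
    and ball: "{c $ 1, c $ 2, c $ 3} \<subseteq> ball z r" and ord: "in_line_order (c $ 1) (c $ 2) (c $ 3)"
    using assms unfolding K3_def by blast
  obtain p u s1 s2 s3 where u: "u \<noteq> 0" and c123: "c $ 1 = p + s1 *\<^sub>R u" "c $ 2 = p + s2 *\<^sub>R u" "c $ 3 = p + s3 *\<^sub>R u"
    and lt: "s1 < s2" "s2 < s3"
    using in_line_orderE[OF ord] .
  obtain k n where kn: "k \<bullet> k = 1" "n \<bullet> n = 1" "k \<bullet> n = 0" and uk: "u = norm u *\<^sub>R k"
    and frame: "\<And>y. y = (y \<bullet> k) *\<^sub>R k + (y \<bullet> n) *\<^sub>R n"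
    using planar_frame[OF u] by metis
  \<comment> \<open>\<open>d\<close> is the signed distance of the line from the centre, and
    \<open>\<sigma> i\<close> the abscissa of \<open>c $ i\<close> measured from the foot of the
    perpendicular.\<close>
  define d where "d = (p - z) \<bullet> n"
  define \<sigma> :: "3 \<Rightarrow> real" where
    "\<sigma> i = (p - z) \<bullet> k + (if i = 1 then s1 else if i = 2 then s2 else s3) * norm u" for i
  have ci: "c $ i = z + \<sigma> i *\<^sub>R k + d *\<^sub>R n" for i
  proof -
    have *: "p + t *\<^sub>R u = z + ((p - z) \<bullet> k + t * norm u) *\<^sub>R k + d *\<^sub>R n" for t
    proof -
      have "p - z + t *\<^sub>R u = ((p - z) \<bullet> k) *\<^sub>R k + ((p - z) \<bullet> n) *\<^sub>R n + (t * norm u) *\<^sub>R k"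
        using frame[of "p - z"] uk by (metis scaleR_scaleR)
      then show ?thesis by (simp add: d_def algebra_simps)
    qed
    show ?thesis using exhaust_3[of i] c123 by (auto simp: \<sigma>_def * )
  qed
  have "(norm (c $ i - z))\<^sup>2 = (\<sigma> i)\<^sup>2 + d\<^sup>2" for i
  proof -
    have "c $ i - z = \<sigma> i *\<^sub>R k + d *\<^sub>R n" by (simp add: ci)
    then show ?thesis
      by (simp add: power2_norm_eq_inner inner_add_left inner_add_right kn inner_commute[of n k])
        (simp add: power2_eq_square)
  qed
  moreover have "norm (c $ i - z) < r" for i
  proof -
    have "c $ i \<in> ball z r" using ball exhaust_3[of i] by auto
    then show ?thesis by (simp add: dist_norm norm_minus_commute)
  qed
  ultimately have in_r: "(\<sigma> i)\<^sup>2 + d\<^sup>2 < r\<^sup>2" for i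
    by (metis norm_ge_zero power_strict_mono zero_less_numeral)
  \<comment> \<open>Half the length of the chord, by Pythagoras; positive because the line has a
    point inside the circle.\<close>
  define h where "h = sqrt (r\<^sup>2 - d\<^sup>2)"
  have "r\<^sup>2 - d\<^sup>2 > 0" using in_r[of 1] by (smt (verit) zero_le_power2)
  then have h: "h > 0" "h\<^sup>2 = r\<^sup>2 - d\<^sup>2" by (simp_all add: h_def)
  interpret chord z k n d r h
    by unfold_locales (simp_all add: kn h r)
  have "\<bar>\<sigma> i\<bar> < h" for i
    unfolding h_def using in_r[of i] by (intro real_less_rsqrt) auto
  moreover have "\<sigma> 1 < \<sigma> 2" "\<sigma> 2 < \<sigma> 3" using lt u by (simp_all add: \<sigma>_def)
  moreover have "c $ i = P (\<sigma> i) 0" for i by (simp add: ci P_def)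
  ultimately show thesis using chart_point that sC C by blast
qed

section \<open>The circle and the collinear hull in a chart\<close>

lemma chart_inj: "chart s \<kappa> \<Gamma> \<Longrightarrow> \<Gamma> x = \<Gamma> y \<longleftrightarrow> x = y"
  unfolding chart_def bij_betw_def by (simp add: inj_eq)

lemma chart_range: "chart s \<kappa> \<Gamma> \<Longrightarrow> range \<Gamma> = set_of s"
  unfolding chart_def bij_betw_def by blast

lemma chart_btw: "chart s \<kappa> \<Gamma> \<Longrightarrow> \<Gamma> z \<in> open_segment (\<Gamma> x) (\<Gamma> y) \<longleftrightarrow> btw \<kappa> x y z"
  unfolding chart_def by blast

lemma chart_Mid: "chart (C, c) \<kappa> \<Gamma> \<Longrightarrow> c $ i = \<Gamma> (Mid i)"
  unfolding chart_def by simp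

lemma chart_circle:
  assumes "(C, c) \<in> K3" "chart (C, c) \<kappa> \<Gamma>"
  shows "\<Gamma> x \<in> C \<longleftrightarrow> x \<notin> range Mid"
proof -
  obtain z r where C: "C = sphere z r" and "{c $ 1, c $ 2, c $ 3} \<subseteq> ball z r"
    using assms(1) unfolding K3_def by blast
  then have "c $ i \<in> ball z r" for i using exhaust_3[of i] by auto
  then have "c $ i \<notin> C" for i using C by fastforce
  then have "\<Gamma> (Mid i) \<notin> C" for i using chart_Mid[OF assms(2)] by simp
  moreover have "\<Gamma> x \<in> C" if "x \<notin> range Mid"
  proof -
    have "\<Gamma> x \<in> C \<union> {c $ 1, c $ 2, c $ 3}" using chart_range[OF assms(2)] by auto
    then show ?thesis using that chart_Mid[OF assms(2)] chart_inj[OF assms(2)] by auto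
  qed
  ultimately show ?thesis by auto
qed

lemma chart_collinear:
  assumes "chart s \<kappa> \<Gamma>" "x \<noteq> y" "y \<noteq> w" "w \<noteq> x"
  shows "collinear {\<Gamma> x, \<Gamma> y, \<Gamma> w} \<longleftrightarrow> btw \<kappa> y w x \<or> btw \<kappa> w x y \<or> btw \<kappa> x y w"
proof -
  have "between (\<Gamma> a, \<Gamma> b) (\<Gamma> c) \<longleftrightarrow> btw \<kappa> a b c" if "c \<noteq> a" "c \<noteq> b" for a b c
    using that chart_btw[OF assms(1)] chart_inj[OF assms(1)]
    by (auto simp: between_mem_segment open_segment_def)
  then show ?thesis using assms(2-4) by (simp add: collinear_between_cases)
qed

text \<open>No arc point is collinear with two points of the line, so the points of the line form a
  closed set. Conversely, \<open>Lo\<close> and \<open>Hi\<close> are collinear with two of the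
  given points.\<close>

lemma c_hull_chart:
  assumes "chart (C, c) \<kappa> \<Gamma>"
  shows "c_hull (set_of (C, c)) {c $ 1, c $ 2, c $ 3} = \<Gamma> ` (range Mid \<union> {Lo, Hi})" (is "?H = \<Gamma> ` ?A")
proof
  note inj = chart_inj[OF assms]
  have "collinearly_closed (set_of (C, c)) (\<Gamma> ` ?A)"
    unfolding collinearly_closed_def
  proof (intro conjI ballI impI)
    show "\<Gamma> ` ?A \<subseteq> set_of (C, c)" using chart_range[OF assms] by blast
    fix w assume "w \<in> set_of (C, c)"
      and ex: "\<exists>a\<in>\<Gamma> ` ?A - {w}. \<exists>b\<in>\<Gamma> ` ?A - {w}. a \<noteq> b \<and> collinear {a, b, w}"
    then obtain w' where w: "w = \<Gamma> w'" using chart_range[OF assms] by blast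
    with ex obtain x y where xy: "x \<in> ?A" "y \<in> ?A" "x \<noteq> y" "y \<noteq> w'" "w' \<noteq> x"
      "collinear {\<Gamma> x, \<Gamma> y, \<Gamma> w'}"
      by blast
    then have "btw \<kappa> y w' x \<or> btw \<kappa> w' x y \<or> btw \<kappa> x y w'"
      using chart_collinear[OF assms xy(3,4,5)] xy(6) by blast
    moreover have "\<not> (btw \<kappa> y (Arc u e) x \<or> btw \<kappa> (Arc u e) x y \<or> btw \<kappa> x y (Arc u e))" for u e
      using xy(1,2) by auto
    ultimately have "w' \<in> ?A" by (cases w') auto
    then show "w \<in> \<Gamma> ` ?A" using w by blast
  qed
  moreover have "{c $ 1, c $ 2, c $ 3} \<subseteq> \<Gamma> ` ?A" using chart_Mid[OF assms] by auto
  ultimately show "?H \<subseteq> \<Gamma> ` ?A" unfolding c_hull_def by (simp add: hull_minimal)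
  have cl: "collinearly_closed (set_of (C, c)) ?H" by (rule collinearly_closed_c_hull) simp
  have "{c $ 1, c $ 2, c $ 3} \<subseteq> ?H" unfolding c_hull_def by (rule hull_subset)
  then have mid: "\<Gamma> (Mid i) \<in> ?H" for i
    using chart_Mid[OF assms, of i] exhaust_3[of i] by auto
  have "\<Gamma> x \<in> ?H" if "x = Lo \<or> x = Hi" for x
  proof -
    have "collinear {\<Gamma> (Mid 1), \<Gamma> (Mid 2), \<Gamma> x}"
      using that by (subst chart_collinear[OF assms]) auto
    moreover have "\<Gamma> (Mid 1) \<in> ?H - {\<Gamma> x}" "\<Gamma> (Mid 2) \<in> ?H - {\<Gamma> x}" "\<Gamma> (Mid 1) \<noteq> \<Gamma> (Mid 2)"
      using mid inj that by auto
    moreover have "\<Gamma> x \<in> set_of (C, c)" using chart_range[OF assms] by blast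
    ultimately show ?thesis using cl unfolding collinearly_closed_def by blast
  qed
  with mid show "\<Gamma> ` ?A \<subseteq> ?H" by blast
qed

section \<open>Cycles\<close>

text \<open>The model of the reversion on arc points. The second equation is a default: the
  reversion itself exchanges \<open>Lo\<close> and \<open>Hi\<close>.\<close>

fun refl_arc :: "(3 \<Rightarrow> real) \<Rightarrow> 3 \<Rightarrow> pt \<Rightarrow> pt" where
  "refl_arc \<kappa> i (Arc u e) = Arc (\<kappa> i - u) (\<not> e)"
| "refl_arc \<kappa> i x = x"

lemma fold_refl_arc_Arc: "\<exists>u' e'. fold (refl_arc \<kappa>) g (Arc u e) = Arc u' e'"
  by (induction g arbitrary: u e) auto

lemma reversion_chart:
  assumes "(C, c) \<in> K3" "chart (C, c) \<kappa> \<Gamma>"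
  shows "reversion C (c $ i) (\<Gamma> (Arc u e)) = \<Gamma> (refl_arc \<kappa> i (Arc u e))"
  unfolding reversion_def
proof (rule the_equality)
  note c = chart_Mid[OF assms(2)] and circle = chart_circle[OF assms] and btw = chart_btw[OF assms(2)]
  show "\<Gamma> (refl_arc \<kappa> i (Arc u e)) \<in> C \<and> c $ i \<in> open_segment (\<Gamma> (Arc u e)) (\<Gamma> (refl_arc \<kappa> i (Arc u e)))"
    by (auto simp: c circle btw)
  fix d assume d: "d \<in> C \<and> c $ i \<in> open_segment (\<Gamma> (Arc u e)) d"
  then have "d \<in> set_of (C, c)" by simp
  then obtain x where x: "d = \<Gamma> x" using chart_range[OF assms(2)] by blast
  with d have "btw \<kappa> (Arc u e) x (Mid i)" by (simp add: c btw)
  then have "x = refl_arc \<kappa> i (Arc u e)" by (cases x) auto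
  then show "d = \<Gamma> (refl_arc \<kappa> i (Arc u e))" using x by simp
qed

lemma act_chart:
  assumes "(C, c) \<in> K3" "chart (C, c) \<kappa> \<Gamma>"
  shows "act (C, c) (\<Gamma> (Arc u e)) g = \<Gamma> (fold (refl_arc \<kappa>) g (Arc u e))"
proof (induction g rule: rev_induct)
  case (snoc i g)
  obtain u' e' where "fold (refl_arc \<kappa>) g (Arc u e) = Arc u' e'" using fold_refl_arc_Arc by blast
  with snoc show ?case by (simp add: reversion_chart[OF assms])
qed simp

text \<open>The points of the circle outside the hull are exactly the arc points, and there the
  reversions are \<open>refl_arc\<close>.\<close>

lemma is_cycle_chart:
  assumes "s \<in> K3" "chart s \<kappa> \<Gamma>"
  shows "is_cycle s v \<longleftrightarrow>
    (\<exists>g u e. distinct_adj g \<and> signature g = v \<and> fold (refl_arc \<kappa>) g (Arc u e) = Arc u e)"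
proof -
  obtain C c where s: "s = (C, c)" by (cases s)
  note K = assms(1)[unfolded s] and ch = assms(2)[unfolded s]
  have arcs: "C - c_hull (set_of (C, c)) {c $ 1, c $ 2, c $ 3} = {\<Gamma> (Arc u e) | u e. True}" (is "?L = ?R")
  proof
    show "?L \<subseteq> ?R"
    proof
      fix x assume x: "x \<in> ?L"
      then have "x \<in> set_of (C, c)" by simp
      then obtain y where "x = \<Gamma> y" using chart_range[OF ch] by blast
      with x show "x \<in> ?R" unfolding c_hull_chart[OF ch]
        by (cases y) (auto simp: chart_circle[OF K ch] chart_inj[OF ch])
    qed
    show "?R \<subseteq> ?L" unfolding c_hull_chart[OF ch]
      by (auto simp: chart_circle[OF K ch] chart_inj[OF ch])
  qed
  have "is_cycle (C, c) v \<longleftrightarrow> (\<exists>g u e. distinct_adj g \<and> signature g = v \<and>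
      act (C, c) (\<Gamma> (Arc u e)) g = \<Gamma> (Arc u e))"
    unfolding is_cycle.simps arcs stab_def G3_def by (simp del: act.simps) blast
  then show ?thesis unfolding s act_chart[OF K ch] chart_inj[OF ch] .
qed

section \<open>Signatures and the action on the arcs\<close>

lemma signature_altdef: "signature g $ j = (\<Sum>m<length g. if g ! m = j then (-1) ^ m else 0)"
proof -
  \<comment> \<open>Shifting the index from \<open>1..n\<close> to \<open>0..<n\<close> turns the
    sign \<open>(-1) ^ (m + 1)\<close> into \<open>(-1) ^ m\<close>.\<close>
  have "signature g $ j = (\<Sum>m \<in> Suc ` {m. m < length g \<and> g ! m = j}. (-1) ^ (m + 1))"
    unfolding signature_def by (simp, rule sum.cong) (auto simp: image_iff Suc_le_eq gr0_conv_Suc)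
  also have "\<dots> = (\<Sum>m \<in> {m. m < length g \<and> g ! m = j}. (-1) ^ m)"
    by (subst sum.reindex) auto
  also have "\<dots> = (\<Sum>m<length g. if g ! m = j then (-1) ^ m else 0)"
    by (simp add: sum.If_cases Int_def lessThan_def)
  finally show ?thesis .
qed

lemma signature_Nil: "signature [] = 0"
  by (simp add: vec_eq_iff signature_altdef)

text \<open>A new first letter moves all others by one place, which reverses their signs.\<close>

lemma signature_Cons: "signature (i # g) $ j = (if i = j then 1 else 0) - signature g $ j"
proof -
  have "signature (i # g) $ j = (if i = j then 1 else 0) + (\<Sum>m<length g. if g ! m = j then (-1) ^ Suc m else 0)"
    by (simp add: signature_altdef sum.lessThan_Suc_shift del: sum.lessThan_Suc power_Suc)
  also have "(\<Sum>m<length g. if g ! m = j then (-1) ^ Suc m else 0) = - signature g $ j"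
    unfolding signature_altdef sum_negf[symmetric] by (rule sum.cong) auto
  finally show ?thesis by simp
qed

definition dot :: "int^3 \<Rightarrow> (3 \<Rightarrow> real) \<Rightarrow> real" where
  "dot v \<kappa> = (\<Sum>i\<in>UNIV. of_int (v $ i) * \<kappa> i)"

lemma dot_signature_Cons: "dot (signature (i # g)) \<kappa> = \<kappa> i - dot (signature g) \<kappa>"
proof -
  have "dot (signature (i # g)) \<kappa> = (\<Sum>j\<in>UNIV. (if i = j then \<kappa> j else 0) - of_int (signature g $ j) * \<kappa> j)"
    unfolding dot_def signature_Cons by (rule sum.cong) (auto simp: algebra_simps)
  then show ?thesis by (simp add: sum_subtractf dot_def)
qed

text \<open>An alternating sum of signs starting with 1. A word that fixes an arc point has even
  length, so this makes cycles balanced.\<close>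

lemma sum_signature: "(\<Sum>i\<in>UNIV. signature g $ i) = (if even (length g) then 0 else 1)"
  by (induction g) (simp_all add: signature_Nil signature_Cons sum_subtractf)

text \<open>A product of reflections of the real line: a translation if the number of letters is
  even, a reflection otherwise. Each letter changes the side.\<close>

lemma fold_refl_arc:
  "fold (refl_arc \<kappa>) g (Arc u e) = Arc ((-1) ^ length g * (u - dot (signature g) \<kappa>)) (e = even (length g))"
proof (induction g arbitrary: u e)
  case Nil
  then show ?case by (simp add: signature_Nil dot_def)
next
  case (Cons i g)
  show ?case by (simp add: Cons.IH dot_signature_Cons) (auto simp: algebra_simps)
qed

text \<open>The last conjunct is the invariant that keeps the word irreducible when a letter of positive
  and a letter of negative multiplicity are put in front of it.\<close>

lemma balanced_signature:
  assumes "balanced v"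
  shows "\<exists>g. distinct_adj g \<and> even (length g) \<and> signature g = v \<and> (g \<noteq> [] \<longrightarrow> v $ hd g > 0)"
  using assms
proof (induction "nat (\<Sum>i\<in>UNIV. \<bar>v $ i\<bar>)" arbitrary: v rule: less_induct)
  case less
  have bal: "v $ 1 + v $ 2 + v $ 3 = 0" using less.prems by (simp add: balanced_def)
  show ?case
  proof (cases "v = 0")
    case True
    then show ?thesis by (intro exI[of _ "[]"]) (auto simp: signature_Nil)
  next
    case False
    then obtain i0 where "v $ i0 \<noteq> 0" by (auto simp: vec_eq_iff)
    then have "v $ 1 \<noteq> 0 \<or> v $ 2 \<noteq> 0 \<or> v $ 3 \<noteq> 0" using exhaust_3[of i0] by auto
    then have "(v $ 1 > 0 \<or> v $ 2 > 0 \<or> v $ 3 > 0) \<and> (v $ 1 < 0 \<or> v $ 2 < 0 \<or> v $ 3 < 0)"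
      using bal by linarith
    then obtain i j where ij: "v $ i > 0" "v $ j < 0" by blast
    then have neq: "i \<noteq> j" by auto
    \<comment> \<open>The leading letters \<open>i\<close> and \<open>j\<close> will count 1 and -1;
      \<open>w\<close> is the signature left for the rest of the word.\<close>
    define w where "w = (\<chi> l. v $ l - (if i = l then 1 else 0) + (if j = l then 1 else 0))"
    have w: "w $ l = v $ l - (if i = l then 1 else 0) + (if j = l then 1 else 0)" for l
      by (simp add: w_def)
    have "balanced w"
    proof -
      have "(\<Sum>l\<in>UNIV. w $ l) = (\<Sum>l\<in>UNIV. v $ l)" by (simp add: w sum.distrib sum_subtractf)
      then show ?thesis using bal by (simp add: balanced_def sum_3)
    qed
    moreover have "(\<Sum>l\<in>UNIV. \<bar>w $ l\<bar>) < (\<Sum>l\<in>UNIV. \<bar>v $ l\<bar>)"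
      by (rule sum_strict_mono_ex1) (use ij neq in \<open>auto simp: w intro!: exI[of _ i]\<close>)
    moreover have "0 \<le> (\<Sum>l\<in>UNIV. \<bar>w $ l\<bar>)" by (simp add: sum_nonneg)
    ultimately have "nat (\<Sum>l\<in>UNIV. \<bar>w $ l\<bar>) < nat (\<Sum>l\<in>UNIV. \<bar>v $ l\<bar>)" "balanced w"
      by linarith+
    then obtain g where g: "distinct_adj g" "even (length g)" "signature g = w" "g \<noteq> [] \<longrightarrow> w $ hd g > 0"
      using less.hyps by blast
    have "g \<noteq> [] \<longrightarrow> j \<noteq> hd g" using g(4) ij(2) neq by (auto simp: w)
    then have "distinct_adj (i # j # g)" using g(1) neq by (cases g) auto
    moreover have "signature (i # j # g) = v"
      by (simp add: vec_eq_iff signature_Cons g(3) w)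
    ultimately show ?thesis using g(2) ij(1) by (intro exI[of _ "i # j # g"]) auto
  qed
qed

text \<open>A word that fixes an arc point preserves its side, so it has even length and acts as the
  translation by \<open>- dot v \<kappa>\<close>, which must vanish. A trivial translation fixes
  every arc point, for instance \<open>Arc 0 True\<close>.\<close>

lemma is_cycle_iff:
  assumes "s \<in> K3" "chart s \<kappa> \<Gamma>"
  shows "is_cycle s v \<longleftrightarrow> balanced v \<and> dot v \<kappa> = 0"
proof
  assume "is_cycle s v"
  then obtain g u e where g: "signature g = v" "fold (refl_arc \<kappa>) g (Arc u e) = Arc u e"
    using is_cycle_chart[OF assms] by blast
  then have "even (length g)" by (auto simp: fold_refl_arc)
  with g sum_signature[of g] show "balanced v \<and> dot v \<kappa> = 0"
    by (simp add: fold_refl_arc balanced_def sum_3)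
next
  assume v: "balanced v \<and> dot v \<kappa> = 0"
  then obtain g where "distinct_adj g" "even (length g)" "signature g = v"
    using balanced_signature by blast
  with v have "distinct_adj g \<and> signature g = v \<and> fold (refl_arc \<kappa>) g (Arc 0 True) = Arc 0 True"
    by (simp add: fold_refl_arc)
  then show "is_cycle s v" using is_cycle_chart[OF assms] by blast
qed

section \<open>Constructing isomorphisms\<close>

text \<open>A map of the arc \<open>True\<close> extends in only one way to the arc \<open>False\<close> so as to commute with the
  reversion through \<open>c\<^sub>1\<close>.\<close>

fun transport :: "(real \<Rightarrow> real) \<Rightarrow> (3 \<Rightarrow> real) \<Rightarrow> (3 \<Rightarrow> real) \<Rightarrow> pt \<Rightarrow> pt" where
  "transport \<phi> \<kappa> \<kappa>' (Arc u e) = (if e then Arc (\<phi> u) e else Arc (\<kappa>' 1 - \<phi> (\<kappa> 1 - u)) e)"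
| "transport \<phi> \<kappa> \<kappa>' x = x"

lemma bij_transport:
  assumes "bij \<phi>"
  shows "bij (transport \<phi> \<kappa> \<kappa>')"
proof (rule bijI)
  have inj: "\<phi> u = \<phi> v \<longleftrightarrow> u = v" for u v using assms by (simp add: bij_def inj_eq)
  show "inj (transport \<phi> \<kappa> \<kappa>')"
  proof (rule injI)
    fix x y assume "transport \<phi> \<kappa> \<kappa>' x = transport \<phi> \<kappa> \<kappa>' y"
    then show "x = y" by (cases x; cases y) (auto simp: inj split: if_splits)
  qed
  show "surj (transport \<phi> \<kappa> \<kappa>')"
  proof (rule surjI)
    fix y
    have \<phi>: "\<phi> (inv_into UNIV \<phi> u) = u" for u using assms by (simp add: bij_is_surj surj_f_inv_f)
    show "transport \<phi> \<kappa> \<kappa>' (case y of Arc u e \<Rightarrow>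
        Arc (if e then inv_into UNIV \<phi> u else \<kappa> 1 - inv_into UNIV \<phi> (\<kappa>' 1 - u)) e | _ \<Rightarrow> y) = y"
      by (cases y) (auto simp: \<phi>)
  qed
qed

text \<open>The chord condition \<open>u + v = \<kappa> i\<close> reads
  \<open>u + (\<kappa> 1 - \<kappa> i) = \<kappa> 1 - v\<close>; apply the injective equivariant map
  \<phi> to both sides.\<close>

lemma btw_transport:
  assumes "bij \<phi>" and shift: "\<forall>i u. \<phi> (u + (\<kappa> 1 - \<kappa> i)) = \<phi> u + (\<kappa>' 1 - \<kappa>' i)"
  shows "btw \<kappa>' (transport \<phi> \<kappa> \<kappa>' x) (transport \<phi> \<kappa> \<kappa>' y) (transport \<phi> \<kappa> \<kappa>' z) \<longleftrightarrow> btw \<kappa> x y z"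
proof -
  have inj: "\<phi> u = \<phi> v \<longleftrightarrow> u = v" for u v using assms(1) by (simp add: bij_def inj_eq)
  have key: "\<phi> u + (\<kappa>' 1 - \<phi> (\<kappa> 1 - v)) = \<kappa>' i \<longleftrightarrow> u + v = \<kappa> i" for u v i
  proof -
    have "\<phi> u + (\<kappa>' 1 - \<phi> (\<kappa> 1 - v)) = \<kappa>' i \<longleftrightarrow> \<phi> (u + (\<kappa> 1 - \<kappa> i)) = \<phi> (\<kappa> 1 - v)"
      by (simp add: shift) linarith
    then show ?thesis unfolding inj by auto
  qed
  have key': "\<kappa>' 1 - \<phi> (\<kappa> 1 - v) + \<phi> u = \<kappa>' i \<longleftrightarrow> v + u = \<kappa> i" for u v i
    using key[of u v i] by (simp add: add.commute)
  have axis: "is_Arc (transport \<phi> \<kappa> \<kappa>' w) \<longleftrightarrow> is_Arc w" "\<not> is_Arc w \<Longrightarrow> transport \<phi> \<kappa> \<kappa>' w = w"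
    "transport \<phi> \<kappa> \<kappa>' w = Mid i \<longleftrightarrow> w = Mid i" for w i
    by (cases w; simp)+
  show ?thesis
  proof (cases "is_Arc x \<and> is_Arc y")
    case True
    then obtain u e v f where xy: "x = Arc u e" "y = Arc v f" by (cases x; cases y) auto
    show ?thesis unfolding xy by (cases e; cases f) (simp_all add: axis key key')
  next
    case False
    then show ?thesis by (cases "is_Arc z") (auto simp: axis)
  qed
qed

lemma isomorphic_if_equivariant:
  assumes "chart s \<kappa> \<Gamma>" "chart s' \<kappa>' \<Gamma>'" "bij \<phi>"
    and "\<forall>i u. \<phi> (u + (\<kappa> 1 - \<kappa> i)) = \<phi> u + (\<kappa>' 1 - \<kappa>' i)"
  shows "betweenness_isomorphic (set_of s) (set_of s')"
proof -
  let ?F = "transport \<phi> \<kappa> \<kappa>'"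
  let ?f = "\<Gamma>' \<circ> (?F \<circ> inv_into UNIV \<Gamma>)"
  have bij: "bij_betw \<Gamma> UNIV (set_of s)" "bij_betw \<Gamma>' UNIV (set_of s')"
    using assms(1,2) by (simp_all add: chart_def)
  have "bij_betw ?f (set_of s) (set_of s')"
    using bij_betw_inv_into[OF bij(1)] bij_transport[OF assms(3)] bij(2)
    by (blast intro: bij_betw_trans)
  moreover have f: "?f (\<Gamma> x) = \<Gamma>' (?F x)" for x
    using bij(1) by (simp add: bij_betw_def)
  have "?f c \<in> open_segment (?f a) (?f b) \<longleftrightarrow> c \<in> open_segment a b"
    if abc: "a \<in> set_of s" "b \<in> set_of s" "c \<in> set_of s" for a b c
  proof -
    obtain x y z where "a = \<Gamma> x" "b = \<Gamma> y" "c = \<Gamma> z"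
      using abc unfolding chart_range[OF assms(1), symmetric] by blast
    then show ?thesis
      by (simp only: f chart_btw[OF assms(1)] chart_btw[OF assms(2)] btw_transport[OF assms(3,4)])
  qed
  ultimately show ?thesis
    unfolding betweenness_isomorphic_def betweenness_isomorphism_def by blast
qed

section \<open>Isomorphisms for rational ratios of gaps\<close>

lemma dot_3: "dot v \<kappa> = of_int (v $ 1) * \<kappa> 1 + of_int (v $ 2) * \<kappa> 2 + of_int (v $ 3) * \<kappa> 3"
  by (simp add: dot_def sum_3)

text \<open>A cycle with \<open>v $ 3 \<noteq> 0\<close> fixes the ratio of the two gaps of
  \<kappa>, so both triples have the same ratio and scaling by \<open>l\<close> is
  equivariant.\<close>

lemma isomorphic_if_common_cycle:
  assumes "s \<in> K3" "s' \<in> K3" "is_cycle s v" "is_cycle s' v" "v $ 3 \<noteq> 0"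
  shows "betweenness_isomorphic (set_of s) (set_of s')"
proof -
  obtain \<kappa> \<Gamma> where ch: "chart s \<kappa> \<Gamma>" using chart_exists[OF assms(1)] .
  obtain \<kappa>' \<Gamma>' where ch': "chart s' \<kappa>' \<Gamma>'" using chart_exists[OF assms(2)] .
  have lt: "\<kappa> 1 < \<kappa> 2" "\<kappa>' 1 < \<kappa>' 2" using ch ch' by (simp_all add: chart_def)
  have v: "dot v \<kappa> = 0" "dot v \<kappa>' = 0" "v $ 2 = - v $ 1 - v $ 3"
    using assms(3,4) is_cycle_iff[OF assms(1) ch] is_cycle_iff[OF assms(2) ch']
    by (auto simp: balanced_def)
  define l where "l = (\<kappa>' 2 - \<kappa>' 1) / (\<kappa> 2 - \<kappa> 1)"
  have l: "l * (\<kappa> 2 - \<kappa> 1) = \<kappa>' 2 - \<kappa>' 1" "l \<noteq> 0" using lt by (auto simp: l_def)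
  have "of_int (v $ 3) * (l * (\<kappa> 3 - \<kappa> 2)) = of_int (v $ 3) * (\<kappa>' 3 - \<kappa>' 2)"
    using v(1,2) l(1) unfolding dot_3 v(3) of_int_diff of_int_minus by algebra
  then have "l * (\<kappa> 3 - \<kappa> 2) = \<kappa>' 3 - \<kappa>' 2" using assms(5) by simp
  with l(1) have "l * (\<kappa> 1 - \<kappa> i) = \<kappa>' 1 - \<kappa>' i" for i
    using exhaust_3[of i] by (auto simp: algebra_simps)
  then have "l * (u + (\<kappa> 1 - \<kappa> i)) = l * u + (\<kappa>' 1 - \<kappa>' i)" for i u
    by (simp add: distrib_left)
  moreover have "bij ((*) l)"
    using l(2) by (intro o_bij[of "\<lambda>x. x / l"]) auto
  ultimately show ?thesis using isomorphic_if_equivariant[OF ch ch'] by blast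
qed

text \<open>\<open>\<theta>\<close> enumerates, by all real numbers, a system of representatives for the cosets of the
  free group spanned by \<open>\<alpha>\<close> and \<open>\<beta>\<close>.\<close>

lemma coset_enumeration:
  fixes \<alpha> \<beta> :: real
  assumes indep: "\<forall>m n :: int. of_int m * \<alpha> + of_int n * \<beta> = 0 \<longrightarrow> m = 0 \<and> n = 0"
  shows "\<exists>\<theta> :: real \<Rightarrow> real. bij (\<lambda>(t, m :: int, n :: int). \<theta> t + of_int m * \<alpha> + of_int n * \<beta>)"
proof -
  \<comment> \<open>The coset of \<open>u\<close> modulo the group spanned by \<alpha> and
    \<beta>.\<close>
  define cl where "cl u = {t. \<exists>m n :: int. u = t + of_int m * \<alpha> + of_int n * \<beta>}" for u
  have cl_self: "u \<in> cl u" for u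
    unfolding cl_def by (rule CollectI, rule exI[of _ 0], rule exI[of _ 0]) simp
  have cl_eq: "cl t = cl u" if tu: "t \<in> cl u" for t u
  proof -
    obtain m n :: int where u: "u = t + of_int m * \<alpha> + of_int n * \<beta>" using tu by (auto simp: cl_def)
    have "w \<in> cl u" if w: "w \<in> cl t" for w
    proof -
      obtain m' n' :: int where "t = w + of_int m' * \<alpha> + of_int n' * \<beta>" using w by (auto simp: cl_def)
      then have "u = w + of_int (m + m') * \<alpha> + of_int (n + n') * \<beta>" using u by (simp add: algebra_simps)
      then show ?thesis unfolding cl_def by blast
    qed
    moreover have "w \<in> cl t" if w: "w \<in> cl u" for w
    proof -
      obtain m' n' :: int where "u = w + of_int m' * \<alpha> + of_int n' * \<beta>" using w by (auto simp: cl_def)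
      then have "t = w + of_int (m' - m) * \<alpha> + of_int (n' - n) * \<beta>" using u by (simp add: algebra_simps)
      then show ?thesis unfolding cl_def by blast
    qed
    ultimately show ?thesis by blast
  qed
  define rep where "rep u = (SOME t. t \<in> cl u)" for u
  have rep: "rep u \<in> cl u" for u unfolding rep_def using cl_self by (rule someI)
  have rep_eq: "rep t = rep u" if "t \<in> cl u" for t u unfolding rep_def cl_eq[OF that] ..
  define T where "T = range rep"
  define g where "g = (\<lambda>(t, m :: int, n :: int). t + of_int m * \<alpha> + of_int n * \<beta>)"
  have "inj_on g (T \<times> UNIV)"
  proof (rule inj_onI)
    fix p p' assume p: "p \<in> T \<times> UNIV" "p' \<in> T \<times> UNIV" and gp: "g p = g p'"
    obtain t m n t' m' n' where pt: "p = (t, m, n)" "p' = (t', m', n')"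
      by (cases p; cases p') auto
    have t: "t \<in> T" "t' \<in> T" and eq: "g (t, m, n) = g (t', m', n')"
      using p gp unfolding pt by auto
    have "t \<in> cl (g (t, m, n))" "t' \<in> cl (g (t', m', n'))" by (auto simp: g_def cl_def)
    then have "rep t = rep t'" using rep_eq eq by metis
    moreover have "rep t = t" "rep t' = t'" using t rep rep_eq unfolding T_def by blast+
    ultimately have tt: "t = t'" by simp
    then have "of_int (m - m') * \<alpha> + of_int (n - n') * \<beta> = 0" using eq by (simp add: g_def algebra_simps)
    then have "m - m' = 0 \<and> n - n' = 0" using indep by blast
    with tt show "p = p'" by (simp add: pt)
  qed
  moreover have "g ` (T \<times> UNIV) = UNIV"
  proof -
    have "u \<in> g ` (T \<times> UNIV)" for u
    proof -
      obtain m n :: int where "u = rep u + of_int m * \<alpha> + of_int n * \<beta>" using rep[of u] by (auto simp: cl_def)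
      then have "u = g (rep u, m, n)" by (simp add: g_def)
      then show ?thesis unfolding T_def by blast
    qed
    then show ?thesis by blast
  qed
  ultimately have g: "bij_betw g (T \<times> UNIV) UNIV" by (simp add: bij_betw_def)
  \<comment> \<open>Finitely many cosets of a countable group would make the reals
    countable.\<close>
  have "infinite T"
  proof
    assume "finite T"
    then have "countable (T \<times> (UNIV :: (int \<times> int) set))" by (simp add: countable_finite)
    then show False using uncountable_bij_betw[OF g uncountable_UNIV_real] by blast
  qed
  then have "(card_of (UNIV :: nat set), card_of T) \<in> ordLeq" by (simp add: infinite_iff_card_of_nat)
  moreover have "(card_of (UNIV :: (int \<times> int) set), card_of (UNIV :: nat set)) \<in> ordLeq"
    by (rule card_of_ordLeqI[of to_nat]) (auto intro: inj_to_nat)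
  ultimately have "(card_of (UNIV :: (int \<times> int) set), card_of T) \<in> ordLeq"
    using ordLeq_transitive by blast
  \<comment> \<open>An infinite set absorbs a countable factor. Together with \<open>g\<close> this
    makes \<open>T\<close> equinumerous with the reals, so representatives can be indexed by
    them.\<close>
  then have "(card_of (T \<times> (UNIV :: (int \<times> int) set)), card_of T) \<in> ordIso"
    using card_of_Times_infinite[OF \<open>infinite T\<close>] by blast
  then obtain f where "bij_betw f (T \<times> (UNIV :: (int \<times> int) set)) T" using card_of_ordIso by blast
  then have "bij_betw (f \<circ> inv_into (T \<times> UNIV) g) UNIV T"
    using bij_betw_inv_into[OF g] bij_betw_trans by blast
  then obtain \<theta> where \<theta>: "bij_betw \<theta> (UNIV :: real set) T" by blast
  have "bij_betw (map_prod \<theta> id) (UNIV \<times> UNIV) (T \<times> (UNIV :: (int \<times> int) set))"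
    using \<theta> by (intro bij_betw_map_prod) auto
  then have "bij_betw (g \<circ> map_prod \<theta> id) (UNIV \<times> UNIV) UNIV" using g bij_betw_trans by blast
  moreover have "g \<circ> map_prod \<theta> id = (\<lambda>(t, m, n). \<theta> t + of_int m * \<alpha> + of_int n * \<beta>)"
    by (auto simp: g_def)
  ultimately have "bij (\<lambda>(t, m :: int, n :: int). \<theta> t + of_int m * \<alpha> + of_int n * \<beta>)" by simp
  then show ?thesis by (intro exI[of _ \<theta>])
qed

text \<open>A vanishing combination with coefficients \<open>m\<close> and \<open>n\<close> is
  itself a cycle, namely \<open>(m + n, - m, - n)\<close>.\<close>

lemma no_cycle_independent:
  assumes "s \<in> K3" "chart s \<kappa> \<Gamma>" "\<forall>v. is_cycle s v \<longrightarrow> v = 0"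
  shows "\<forall>m n :: int. of_int m * (\<kappa> 1 - \<kappa> 2) + of_int n * (\<kappa> 1 - \<kappa> 3) = 0 \<longrightarrow> m = 0 \<and> n = 0"
proof (intro allI impI)
  fix m n :: int
  assume 0: "of_int m * (\<kappa> 1 - \<kappa> 2) + of_int n * (\<kappa> 1 - \<kappa> 3) = 0"
  define v :: "int^3" where "v = (\<chi> i. if i = 1 then m + n else if i = 2 then - m else - n)"
  have v: "v $ 1 = m + n" "v $ 2 = - m" "v $ 3 = - n" by (simp_all add: v_def)
  have "is_cycle s v"
    unfolding is_cycle_iff[OF assms(1,2)] using 0
    by (simp add: balanced_def dot_3 v algebra_simps)
  then have "v = 0" using assms(3) by blast
  then show "m = 0 \<and> n = 0" using v by simp
qed

text \<open>Both real lines are parametrized by triples \<open>(t, m, n)\<close>. Matching equal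
  triples is equivariant, since the translations by \<open>\<kappa> 1 - \<kappa> 2\<close> and
  \<open>\<kappa> 1 - \<kappa> 3\<close> raise \<open>m\<close> and \<open>n\<close> by one.\<close>

lemma isomorphic_if_no_cycles:
  assumes "s \<in> K3" "s' \<in> K3" "\<forall>v. is_cycle s v \<longrightarrow> v = 0" "\<forall>v. is_cycle s' v \<longrightarrow> v = 0"
  shows "betweenness_isomorphic (set_of s) (set_of s')"
proof -
  obtain \<kappa> \<Gamma> where ch: "chart s \<kappa> \<Gamma>" using chart_exists[OF assms(1)] .
  obtain \<kappa>' \<Gamma>' where ch': "chart s' \<kappa>' \<Gamma>'" using chart_exists[OF assms(2)] .
  obtain \<theta> :: "real \<Rightarrow> real" where \<theta>: "bij (\<lambda>(t, m :: int, n :: int). \<theta> t + of_int m * (\<kappa> 1 - \<kappa> 2) + of_int n * (\<kappa> 1 - \<kappa> 3))"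
    (is "bij ?G") using coset_enumeration[of "\<kappa> 1 - \<kappa> 2" "\<kappa> 1 - \<kappa> 3",
      OF no_cycle_independent[OF assms(1) ch assms(3)]] by blast
  obtain \<theta>' :: "real \<Rightarrow> real" where \<theta>': "bij (\<lambda>(t, m :: int, n :: int). \<theta>' t + of_int m * (\<kappa>' 1 - \<kappa>' 2) + of_int n * (\<kappa>' 1 - \<kappa>' 3))"
    (is "bij ?G'") using coset_enumeration[of "\<kappa>' 1 - \<kappa>' 2" "\<kappa>' 1 - \<kappa>' 3",
      OF no_cycle_independent[OF assms(2) ch' assms(4)]] by blast
  define \<phi> where "\<phi> = ?G' \<circ> inv_into UNIV ?G"
  have "bij \<phi>" unfolding \<phi>_def using \<theta> \<theta>' by (blast intro: bij_comp bij_imp_bij_inv)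
  moreover have \<phi>: "\<phi> (?G p) = ?G' p" for p
    using \<theta> by (simp add: \<phi>_def bij_is_inj inv_f_f)
  have "\<phi> (u + (\<kappa> 1 - \<kappa> i)) = \<phi> u + (\<kappa>' 1 - \<kappa>' i)" for i u
  proof -
    obtain p where "u = ?G p" using surjD[OF bij_is_surj[OF \<theta>]] by blast
    then obtain t m n where u: "u = ?G (t, m, n)" by (cases p) blast
    have "\<exists>m' n'. u + (\<kappa> 1 - \<kappa> i) = ?G (t, m', n') \<and> ?G' (t, m, n) + (\<kappa>' 1 - \<kappa>' i) = ?G' (t, m', n')"
      using exhaust_3[of i]
    proof (elim disjE)
      assume "i = 1" then show ?thesis using u by (intro exI[of _ m] exI[of _ n]) simp
    next
      assume "i = 2" then show ?thesis using u
        by (intro exI[of _ "m + 1"] exI[of _ n]) (simp add: algebra_simps)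
    next
      assume "i = 3" then show ?thesis using u
        by (intro exI[of _ m] exI[of _ "n + 1"]) (simp add: algebra_simps)
    qed
    then obtain m' n' where eq: "u + (\<kappa> 1 - \<kappa> i) = ?G (t, m', n')"
      "?G' (t, m, n) + (\<kappa>' 1 - \<kappa>' i) = ?G' (t, m', n')"
      by blast
    have "\<phi> u = ?G' (t, m, n)" unfolding u by (rule \<phi>)
    moreover have "\<phi> (u + (\<kappa> 1 - \<kappa> i)) = ?G' (t, m', n')" unfolding eq(1) by (rule \<phi>)
    ultimately show ?thesis using eq(2) by (simp only:)
  qed
  ultimately show ?thesis using isomorphic_if_equivariant[OF ch ch'] by blast
qed

section \<open>Isomorphisms preserve cycles\<close>

fun swap :: "3 \<Rightarrow> 3" where
  "swap i = (if i = 1 then 3 else if i = 3 then 1 else i)"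

lemma swap_swap: "swap (swap i) = i"
  by simp

definition flip :: "'a^3 \<Rightarrow> 'a^3" where
  "flip v = (\<chi> i. v $ swap i)"

lemma flip_nth [simp]: "flip v $ 1 = v $ 3" "flip v $ 2 = v $ 2" "flip v $ 3 = v $ 1"
  by (simp_all add: flip_def)

lemma flip_flip [simp]: "flip (flip v) = v"
  unfolding flip_def by (simp add: vec_eq_iff del: swap.simps add: swap_swap)

definition flip_triple :: "(real^2) set \<times> ((real^2)^3) \<Rightarrow> (real^2) set \<times> ((real^2)^3)" where
  "flip_triple s = (fst s, flip (snd s))"

lemma set_of_flip_triple [simp]: "set_of (flip_triple s) = set_of s"
  by (cases s) (auto simp: flip_triple_def)

lemma in_line_order_sym: "in_line_order a b c \<Longrightarrow> in_line_order c b a"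
  unfolding in_line_order_def by metis

lemma flip_triple_K3:
  assumes "s \<in> K3"
  shows "flip_triple s \<in> K3"
proof -
  obtain C c where s: "s = (C, c)" by (cases s)
  then obtain z r where "0 < r" "C = sphere z r" "{c $ 1, c $ 2, c $ 3} \<subseteq> ball z r"
    "c $ 1 \<noteq> c $ 2" "c $ 1 \<noteq> c $ 3" "c $ 2 \<noteq> c $ 3" "collinear {c $ 1, c $ 2, c $ 3}"
    "in_line_order (c $ 1) (c $ 2) (c $ 3)"
    using assms unfolding K3_def by blast
  then show ?thesis
    unfolding K3_def s flip_triple_def fst_conv snd_conv mem_Collect_eq case_prod_conv flip_nth
    by (intro exI[of _ z] exI[of _ r]) (simp add: insert_commute in_line_order_sym)
qed

fun flip_pt :: "pt \<Rightarrow> pt" where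
  "flip_pt Lo = Hi"
| "flip_pt Hi = Lo"
| "flip_pt (Mid i) = Mid (swap i)"
| "flip_pt (Arc u e) = Arc (- u) e"

lemma flip_pt_flip_pt: "flip_pt (flip_pt x) = x"
  by (cases x) (simp_all del: swap.simps add: swap_swap)

text \<open>Exchanging \<open>Lo\<close> and \<open>Hi\<close> inverts the ratios of distances, so
  the logarithms change sign; the sides stay.\<close>

lemma chart_flip_triple:
  assumes "chart s \<kappa> \<Gamma>"
  shows "chart (flip_triple s) (\<lambda>i. - \<kappa> (swap i)) (\<Gamma> \<circ> flip_pt)"
proof -
  have "bij flip_pt" by (rule o_bij[of flip_pt]) (auto simp: flip_pt_flip_pt)
  then have "bij_betw (\<Gamma> \<circ> flip_pt) UNIV (set_of (flip_triple s))"
    using assms unfolding chart_def set_of_flip_triple by (blast intro: bij_betw_trans)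
  moreover have "btw \<kappa> (flip_pt x) (flip_pt y) (flip_pt z) \<longleftrightarrow> btw (\<lambda>i. - \<kappa> (swap i)) x y z" for x y z
  proof (cases "is_Arc x \<and> is_Arc y")
    case True
    then obtain u e v f where xy: "x = Arc u e" "y = Arc v f" by (cases x; cases y) auto
    have "- u - v = \<kappa> (swap j) \<longleftrightarrow> u + v = - \<kappa> (swap j)" for j
      by linarith
    then show ?thesis unfolding xy by (cases z) (simp_all del: swap.simps)
  next
    case False
    have arc: "is_Arc (flip_pt w) \<longleftrightarrow> is_Arc w" for w by (cases w) auto
    have "swap i = 1 \<longleftrightarrow> i = 3" "swap i = 2 \<longleftrightarrow> i = 2" for i
      using exhaust_3[of i] by auto
    then have pos: "pos (flip_pt w) + pos w = 4" if "\<not> is_Arc w" for w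
      using that exhaust_3 by (cases w) (auto simp del: swap.simps)
    have "pos (flip_pt w) < pos (flip_pt w') \<longleftrightarrow> pos w' < pos w" if "\<not> is_Arc w" "\<not> is_Arc w'" for w w'
      using pos[OF that(1)] pos[OF that(2)] by linarith
    then show ?thesis using False by (auto simp: arc)
  qed
  moreover have "(\<Gamma> \<circ> flip_pt) z \<in> open_segment ((\<Gamma> \<circ> flip_pt) x) ((\<Gamma> \<circ> flip_pt) y) \<longleftrightarrow>
      btw \<kappa> (flip_pt x) (flip_pt y) (flip_pt z)" for x y z
    by (simp add: chart_btw[OF assms])
  moreover have "(\<Gamma> \<circ> flip_pt) (Mid i) = snd (flip_triple s) $ i" for i
    using assms by (simp add: chart_def flip_triple_def flip_def del: swap.simps)
  moreover have "- \<kappa> (swap 1) < - \<kappa> (swap 2)" "- \<kappa> (swap 2) < - \<kappa> (swap 3)"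
    using assms by (simp_all add: chart_def)
  ultimately show ?thesis unfolding chart_def by blast
qed

lemma is_cycle_flip_triple:
  assumes "s \<in> K3"
  shows "is_cycle (flip_triple s) v \<longleftrightarrow> is_cycle s (flip v)"
proof -
  obtain \<kappa> \<Gamma> where ch: "chart s \<kappa> \<Gamma>" using chart_exists[OF assms] .
  show ?thesis
    unfolding is_cycle_iff[OF assms ch] is_cycle_iff[OF flip_triple_K3[OF assms] chart_flip_triple[OF ch]]
    by (auto simp: balanced_def dot_3)
qed

section \<open>Isomorphisms read in charts\<close>

lemma isomorphism_transition:
  assumes "betweenness_isomorphism f (set_of s) (set_of s')" "chart s \<kappa> \<Gamma>" "chart s' \<kappa>' \<Gamma>'"
  obtains F where "bij F" "\<And>x. f (\<Gamma> x) = \<Gamma>' (F x)" "\<And>x y z. btw \<kappa>' (F x) (F y) (F z) \<longleftrightarrow> btw \<kappa> x y z"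
proof -
  have bij: "bij_betw \<Gamma> UNIV (set_of s)" "bij_betw \<Gamma>' UNIV (set_of s')"
    using assms(2,3) by (simp_all add: chart_def)
  define F where "F = inv_into UNIV \<Gamma>' \<circ> (f \<circ> \<Gamma>)"
  have f: "bij_betw f (set_of s) (set_of s')"
    and seg: "\<And>a b c. a \<in> set_of s \<Longrightarrow> b \<in> set_of s \<Longrightarrow> c \<in> set_of s \<Longrightarrow>
      c \<in> open_segment a b \<longleftrightarrow> f c \<in> open_segment (f a) (f b)"
    using assms(1) unfolding betweenness_isomorphism_def by blast+
  have "bij F"
    unfolding F_def using bij_betw_inv_into[OF bij(2)] bij(1) f by (blast intro: bij_betw_trans)
  moreover have \<Gamma>: "\<Gamma> x \<in> set_of s" for x using bij(1) bij_betwE by blast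
  have F: "f (\<Gamma> x) = \<Gamma>' (F x)" for x
  proof -
    have "f (\<Gamma> x) \<in> range \<Gamma>'" using \<Gamma> f bij(2) bij_betwE unfolding bij_betw_def by blast
    then show ?thesis by (simp add: F_def f_inv_into_f)
  qed
  moreover have "btw \<kappa>' (F x) (F y) (F z) \<longleftrightarrow> btw \<kappa> x y z" for x y z
    using seg[OF \<Gamma> \<Gamma> \<Gamma>, of z x y] by (simp add: F chart_btw[OF assms(2)] chart_btw[OF assms(3)])
  ultimately show thesis using that by blast
qed

lemma pos_le_4: "pos x \<le> 4"
  by (cases x) auto

text \<open>Characterizes the three inner points by betweenness alone, so that isomorphisms must
  preserve them. Each lies on a chord from arc to arc, and a point of the circle lies in no open
  segment.\<close>

lemma in_range_Mid_iff: "x \<in> range Mid \<longleftrightarrow> (\<exists>y z. btw \<kappa> y z x)"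
proof (cases x)
  case (Mid i)
  have "btw \<kappa> (Arc 0 True) (Arc (\<kappa> i) False) (Mid i)" by simp
  then show ?thesis using Mid by blast
next
  case Hi
  have "\<not> btw \<kappa> y z Hi" for y z
    using pos_le_4[of y] pos_le_4[of z] by (cases "is_Arc y \<and> is_Arc z") (auto simp: is_Arc_def)
  then show ?thesis using Hi by auto
next
  case Lo
  have "\<not> btw \<kappa> y z Lo" for y z
    by (cases "is_Arc y \<and> is_Arc z") (auto simp: is_Arc_def)
  then show ?thesis using Lo by auto
qed auto

text \<open>Separates arc points from \<open>Lo\<close> and \<open>Hi\<close> by betweenness: from
  the latter, one inner point is seen behind another.\<close>

lemma is_Arc_iff: "is_Arc x \<longleftrightarrow> x \<notin> range Mid \<and> \<not> (\<exists>i y. btw \<kappa> x (Mid i) y)"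
proof (cases x)
  case Lo
  then have "btw \<kappa> x (Mid 2) (Mid 1)" "\<not> is_Arc x" by simp_all
  then show ?thesis by blast
next
  case Hi
  then have "btw \<kappa> x (Mid 2) (Mid 3)" "\<not> is_Arc x" by simp_all
  then show ?thesis by blast
qed auto

lemma transition_Mid_Arc:
  assumes "bij F" "\<And>x y z. btw \<kappa>' (F x) (F y) (F z) \<longleftrightarrow> btw \<kappa> x y z"
  shows "F x \<in> range Mid \<longleftrightarrow> x \<in> range Mid" "is_Arc (F x) \<longleftrightarrow> is_Arc x"
proof -
  have surj: "\<exists>x. y = F x" for y using assms(1) by (metis bij_pointE)
  show mid: "F x \<in> range Mid \<longleftrightarrow> x \<in> range Mid" for x
  proof -
    have "(\<exists>y z. btw \<kappa>' y z (F x)) \<longleftrightarrow> (\<exists>y z. btw \<kappa>' (F y) (F z) (F x))" using surj by metis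
    then show ?thesis
      unfolding in_range_Mid_iff[of x \<kappa>] in_range_Mid_iff[of "F x" \<kappa>'] assms(2) .
  qed
  have ax: "(\<exists>i y. btw \<kappa> x (Mid i) y) \<longleftrightarrow> (\<exists>m y. m \<in> range Mid \<and> btw \<kappa> x m y)" for \<kappa> x by blast
  have "(\<exists>m y. m \<in> range Mid \<and> btw \<kappa>' (F x) m y) \<longleftrightarrow>
      (\<exists>m y. F m \<in> range Mid \<and> btw \<kappa>' (F x) (F m) (F y))" using surj by metis
  then have "(\<exists>i y. btw \<kappa>' (F x) (Mid i) y) \<longleftrightarrow> (\<exists>i y. btw \<kappa> x (Mid i) y)"
    unfolding ax assms(2) mid .
  then show "is_Arc (F x) \<longleftrightarrow> is_Arc x"
    unfolding is_Arc_iff[of x \<kappa>] is_Arc_iff[of "F x" \<kappa>'] mid by (simp only:)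
qed

text \<open>The image of an arc point under \<open>refl_arc\<close> is the only one joined to it
  through \<open>Mid i\<close>. Since \<open>F\<close> fixes each \<open>Mid i\<close>, it commutes
  with the reversions, and a word fixing a point fixes its image.\<close>

lemma cycle_transfer:
  assumes "s \<in> K3" "s' \<in> K3" "betweenness_isomorphism f (set_of s) (set_of s')"
    and "\<And>i. f (snd s $ i) = snd s' $ i" "is_cycle s v"
  shows "is_cycle s' v"
proof -
  obtain \<kappa> \<Gamma> where ch: "chart s \<kappa> \<Gamma>" using chart_exists[OF assms(1)] .
  obtain \<kappa>' \<Gamma>' where ch': "chart s' \<kappa>' \<Gamma>'" using chart_exists[OF assms(2)] .
  obtain F where F: "bij F" "\<And>x. f (\<Gamma> x) = \<Gamma>' (F x)" "\<And>x y z. btw \<kappa>' (F x) (F y) (F z) \<longleftrightarrow> btw \<kappa> x y z"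
    using isomorphism_transition[OF assms(3) ch ch'] by blast
  note arc = transition_Mid_Arc(2)[OF F(1,3)]
  have mid: "F (Mid i) = Mid i" for i
  proof -
    have "\<Gamma>' (F (Mid i)) = \<Gamma>' (Mid i)" using F(2)[of "Mid i"] assms(4) ch ch' by (simp add: chart_def)
    then show ?thesis using chart_inj[OF ch'] by blast
  qed
  have step: "F (refl_arc \<kappa> i (Arc u e)) = refl_arc \<kappa>' i (F (Arc u e))" for i u e
  proof -
    obtain u1 e1 where 1: "F (Arc u e) = Arc u1 e1" using arc[of "Arc u e"] by (auto simp: is_Arc_def)
    obtain u2 e2 where 2: "F (Arc (\<kappa> i - u) (\<not> e)) = Arc u2 e2"
      using arc[of "Arc (\<kappa> i - u) (\<not> e)"] by (auto simp: is_Arc_def)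
    have "btw \<kappa>' (Arc u1 e1) (Arc u2 e2) (Mid i)"
      using F(3)[of "Arc u e" "Arc (\<kappa> i - u) (\<not> e)" "Mid i"] by (simp add: 1 2 mid)
    then show ?thesis using 1 2 by auto
  qed
  have fold: "F (fold (refl_arc \<kappa>) g (Arc u e)) = fold (refl_arc \<kappa>') g (F (Arc u e))" for g u e
    by (induction g arbitrary: u e) (simp_all add: step[simplified])
  obtain g u e where g: "distinct_adj g" "signature g = v" "fold (refl_arc \<kappa>) g (Arc u e) = Arc u e"
    using assms(5) is_cycle_chart[OF assms(1) ch] by blast
  obtain u' e' where "F (Arc u e) = Arc u' e'" using arc[of "Arc u e"] by (auto simp: is_Arc_def)
  then have "fold (refl_arc \<kappa>') g (Arc u' e') = Arc u' e'" using fold[of g u e] g(3) by simp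
  then show ?thesis using g(1,2) is_cycle_chart[OF assms(2) ch'] by blast
qed

lemma isomorphic_cycles:
  assumes "s \<in> K3" "s' \<in> K3" "betweenness_isomorphic (set_of s) (set_of s')" "is_cycle s v"
  shows "is_cycle s' v \<or> is_cycle (flip_triple s') v"
proof -
  obtain f where f: "betweenness_isomorphism f (set_of s) (set_of s')"
    using assms(3) by (auto simp: betweenness_isomorphic_def)
  obtain \<kappa> \<Gamma> where ch: "chart s \<kappa> \<Gamma>" using chart_exists[OF assms(1)] .
  obtain \<kappa>' \<Gamma>' where ch': "chart s' \<kappa>' \<Gamma>'" using chart_exists[OF assms(2)] .
  obtain F where F: "bij F" "\<And>x. f (\<Gamma> x) = \<Gamma>' (F x)" "\<And>x y z. btw \<kappa>' (F x) (F y) (F z) \<longleftrightarrow> btw \<kappa> x y z"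
    using isomorphism_transition[OF f ch ch'] by blast
  have "\<exists>j. F (Mid i) = Mid j" for i using transition_Mid_Arc(1)[OF F(1,3), of "Mid i"] by auto
  then obtain \<pi> where \<pi>: "\<And>i. F (Mid i) = Mid (\<pi> i)" by metis
  have f\<pi>: "f (snd s $ i) = snd s' $ \<pi> i" for i
    using F(2)[of "Mid i"] \<pi> ch ch' by (simp add: chart_def)
  have "btw \<kappa>' (Mid (\<pi> 1)) (Mid (\<pi> 3)) (Mid (\<pi> 2))"
    using F(3)[of "Mid 1" "Mid 3" "Mid 2"] by (simp add: \<pi>)
  \<comment> \<open>The middle point stays in the middle, which leaves the identity and the
    reversal.\<close>
  then have "\<pi> 1 = 1 \<and> \<pi> 2 = 2 \<and> \<pi> 3 = 3 \<or> \<pi> 1 = 3 \<and> \<pi> 2 = 2 \<and> \<pi> 3 = 1"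
    using exhaust_3[of "\<pi> 1"] exhaust_3[of "\<pi> 2"] exhaust_3[of "\<pi> 3"] by auto
  then show ?thesis
  proof (elim disjE conjE)
    assume "\<pi> 1 = 1" "\<pi> 2 = 2" "\<pi> 3 = 3"
    then have "f (snd s $ i) = snd s' $ i" for i using f\<pi>[of i] exhaust_3[of i] by auto
    then show ?thesis using cycle_transfer[OF assms(1,2) f _ assms(4)] by blast
  next
    assume "\<pi> 1 = 3" "\<pi> 2 = 2" "\<pi> 3 = 1"
    then have "f (snd s $ i) = snd (flip_triple s') $ i" for i
      using f\<pi>[of i] exhaust_3[of i] by (auto simp: flip_triple_def)
    moreover have "betweenness_isomorphism f (set_of s) (set_of (flip_triple s'))" using f by simp
    ultimately show ?thesis
      using cycle_transfer[OF assms(1) flip_triple_K3[OF assms(2)] _ _ assms(4)] by blast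
  qed
qed

section \<open>The classification\<close>

lemma in_line_order_between:
  assumes "between (a, c) b" "a \<noteq> b" "b \<noteq> c"
  shows "in_line_order a b c"
proof -
  have "b \<in> open_segment a c" using assms by (auto simp: between_mem_segment open_segment_def)
  then obtain t where t: "a \<noteq> c" "0 < t" "t < 1" "b = (1 - t) *\<^sub>R a + t *\<^sub>R c"
    by (auto simp: in_segment)
  then show ?thesis unfolding in_line_order_def
    by (intro exI[of _ a] exI[of _ "c - a"] exI[of _ 0] exI[of _ t] exI[of _ 1])
      (auto simp: algebra_simps)
qed

text \<open>Of three collinear points one lies between the others; it is listed second.\<close>

lemma circles_with_three_points_eq: "circles_with_three_points = set_of ` K3"
proof
  show "set_of ` K3 \<subseteq> circles_with_three_points"
  proof (rule image_subsetI)
    fix s assume "s \<in> K3"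
    moreover obtain C c where s: "s = (C, c)" by (cases s)
    ultimately show "set_of s \<in> circles_with_three_points"
      unfolding K3_def circles_with_three_points_def s set_of.simps by blast
  qed
  show "circles_with_three_points \<subseteq> set_of ` K3"
  proof
    fix S assume "S \<in> circles_with_three_points"
    then obtain z r a b c where S: "S = sphere z r \<union> {a, b, c}" and r: "0 < r"
      and ball: "{a, b, c} \<subseteq> ball z r" and ne: "a \<noteq> b" "a \<noteq> c" "b \<noteq> c" and col: "collinear {a, b, c}"
      unfolding circles_with_three_points_def by blast
    have mem: "sphere z r \<union> {x, y, w} \<in> set_of ` K3"
      if "{x, y, w} = {a, b, c}" "x \<noteq> y" "x \<noteq> w" "y \<noteq> w" "between (x, w) y" for x y w
    proof -
      define p :: "(real^2)^3" where "p = (\<chi> i. if i = 1 then x else if i = 2 then y else w)"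
      have p: "p $ 1 = x" "p $ 2 = y" "p $ 3 = w" by (simp_all add: p_def)
      have "(sphere z r, p) \<in> K3"
        unfolding K3_def using r ball col that in_line_order_between[OF that(5,2,4)] by (auto simp only: p mem_Collect_eq case_prod_conv)
      then show ?thesis by (intro image_eqI[of _ _ "(sphere z r, p)"]) (simp_all add: p)
    qed
    have "between (b, c) a \<or> between (c, a) b \<or> between (a, b) c"
      using col by (simp add: collinear_between_cases)
    then show "S \<in> set_of ` K3"
    proof (elim disjE)
      assume "between (b, c) a"
      with mem[of b a c] ne show ?thesis by (auto simp: S insert_commute)
    next
      assume "between (c, a) b"
      with mem[of c b a] ne show ?thesis by (auto simp: S insert_commute)
    next
      assume "between (a, b) c"
      with mem[of a c b] ne show ?thesis by (auto simp: S insert_commute)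
    qed
  qed
qed

text \<open>In the unit circle with a diameter as the line, \<open>ln ((1 + s) / (1 - s))\<close> is
  twice \<open>artanh s\<close>, which is inverted by \<open>tanh (\<kappa> i / 2)\<close>.\<close>

lemma chart_realizable:
  assumes "\<kappa> 1 < \<kappa> 2" "\<kappa> 2 < \<kappa> 3"
  obtains s \<Gamma> where "s \<in> K3" "chart s \<kappa> \<Gamma>"
proof -
  interpret chord "0 :: real^2" "axis 1 1" "axis 2 1" 0 1 1
    by unfold_locales (simp_all add: inner_axis_axis)
  define \<sigma> where "\<sigma> i = tanh (\<kappa> i / 2)" for i :: 3
  define c :: "(real^2)^3" where "c = (\<chi> i. P (\<sigma> i) 0)"
  have c: "c $ i = P (\<sigma> i) 0" for i by (simp add: c_def)
  have Pc: "P (\<sigma> i) 0 = \<sigma> i *\<^sub>R axis 1 1" for i by (simp add: P_def)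
  have abs: "\<bar>\<sigma> i\<bar> < 1" for i
    unfolding \<sigma>_def abs_less_iff using tanh_real_lt_1[of "\<kappa> i / 2"] tanh_real_gt_neg1[of "\<kappa> i / 2"] by linarith
  have lt: "\<sigma> 1 < \<sigma> 2" "\<sigma> 2 < \<sigma> 3" using assms by (simp_all add: \<sigma>_def)
  have "ln ((1 + \<sigma> i) / (1 - \<sigma> i)) = \<kappa> i" for i
    using artanh_tanh_real[of "\<kappa> i / 2"] by (simp add: artanh_def \<sigma>_def)
  then have "chart (sphere 0 1, c) \<kappa> (point \<sigma>)"
    using chart_point[OF lt abs c] by simp
  moreover have "(sphere 0 1, c) \<in> K3"
  proof -
    have "c $ i \<in> ball 0 1" for i using abs[of i] by (simp add: c Pc)
    moreover have "collinear {c $ 1, c $ 2, c $ 3}"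
      unfolding collinear_def
    proof (intro exI[of _ "axis 1 1"] ballI)
      fix x y assume "x \<in> {c $ 1, c $ 2, c $ 3}" "y \<in> {c $ 1, c $ 2, c $ 3}"
      then obtain i j where "x = c $ i" "y = c $ j" by auto
      then have "x - y = (\<sigma> i - \<sigma> j) *\<^sub>R axis 1 1" by (simp add: c Pc scaleR_diff_left)
      then show "\<exists>t. x - y = t *\<^sub>R axis 1 1" ..
    qed
    moreover have "in_line_order (c $ 1) (c $ 2) (c $ 3)"
      unfolding in_line_order_def
      by (rule exI[of _ 0], rule exI[of _ "axis 1 1"], rule exI[of _ "\<sigma> 1"], rule exI[of _ "\<sigma> 2"], rule exI[of _ "\<sigma> 3"])
        (use lt in \<open>simp add: c Pc axis_eq_0_iff\<close>)
    moreover have "c $ 1 \<noteq> c $ 2" "c $ 1 \<noteq> c $ 3" "c $ 2 \<noteq> c $ 3" using lt by (simp_all add: c)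
    ultimately show ?thesis
      unfolding K3_def mem_Collect_eq case_prod_conv
      by (intro exI[of _ "0 :: real^2"] exI[of _ "1 :: real"]) (simp del: mem_ball)
  qed
  ultimately show thesis using that by blast
qed

section \<open>Normal form of the cycles\<close>

lemma is_cycle_ratio:
  assumes "s \<in> K3"
  obtains a b :: real where "a > 0" "b > 0"
    "\<forall>v. is_cycle s v \<longleftrightarrow> balanced v \<and> of_int (v $ 1) * a = of_int (v $ 3) * b"
proof -
  obtain \<kappa> \<Gamma> where ch: "chart s \<kappa> \<Gamma>" using chart_exists[OF assms] .
  \<comment> \<open>The positive numbers sought are the gaps of \<kappa>; balance eliminates
    \<open>v $ 2\<close> from \<open>dot v \<kappa>\<close>.\<close>
  have "is_cycle s v \<longleftrightarrow> balanced v \<and> of_int (v $ 1) * (\<kappa> 2 - \<kappa> 1) = of_int (v $ 3) * (\<kappa> 3 - \<kappa> 2)" for v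
  proof (cases "balanced v")
    case True
    then have "v $ 2 = - v $ 1 - v $ 3" by (simp add: balanced_def)
    then have "dot v \<kappa> = of_int (v $ 3) * (\<kappa> 3 - \<kappa> 2) - of_int (v $ 1) * (\<kappa> 2 - \<kappa> 1)"
      unfolding dot_3 \<open>v $ 2 = _\<close> by (simp add: algebra_simps)
    then show ?thesis using True unfolding is_cycle_iff[OF assms ch] by auto
  qed (simp add: is_cycle_iff[OF assms ch])
  moreover have "\<kappa> 2 - \<kappa> 1 > 0" "\<kappa> 3 - \<kappa> 2 > 0" using ch by (simp_all add: chart_def)
  ultimately show thesis using that by blast
qed

lemma is_cycle_0: "s \<in> K3 \<Longrightarrow> is_cycle s 0"
  by (rule is_cycle_ratio[of s]) (simp_all add: balanced_def)

lemma class_vectors_coprime: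
  assumes "v \<in> class_vectors"
  shows "coprime (v $ 1) (v $ 3)"
proof (rule coprimeI)
  fix d assume d: "d dvd v $ 1" "d dvd v $ 3"
  have v: "v $ 2 = - (v $ 1 + v $ 3)" "Gcd {v $ 1, v $ 2, v $ 3} = 1"
    using assms by (auto simp: class_vectors_def balanced_def)
  have "d dvd v $ 2" unfolding v(1) using d by simp
  then have "d dvd Gcd {v $ 1, v $ 2, v $ 3}" using d by (intro Gcd_greatest) auto
  then show "is_unit d" unfolding v(2) .
qed

text \<open>The gaps are positive, so the outer entries of a nonzero cycle are nonzero and of equal
  sign. Dividing them by their gcd and making them negative gives a cycle again; reversing the three
  points, if necessary, orders them.\<close>

lemma nontrivial_cycle_class:
  assumes "s \<in> K3" "is_cycle s w" "w \<noteq> 0"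
  shows "\<exists>v\<in>class_vectors. is_cycle s v \<or> is_cycle (flip_triple s) v"
proof -
  obtain a b :: real where ab: "a > 0" "b > 0"
    and cyc: "\<forall>v. is_cycle s v \<longleftrightarrow> balanced v \<and> of_int (v $ 1) * a = of_int (v $ 3) * b"
    using is_cycle_ratio[OF assms(1)] .
  have w: "w $ 1 + w $ 2 + w $ 3 = 0" "of_int (w $ 1) * a = of_int (w $ 3) * b"
    using assms(2) cyc by (simp_all add: balanced_def)
  have "w $ 1 \<noteq> 0 \<or> w $ 3 \<noteq> 0"
  proof (rule ccontr)
    assume "\<not> ?thesis"
    then have "w $ 1 = 0 \<and> w $ 2 = 0 \<and> w $ 3 = 0" using w(1) by simp
    then have "w = 0" by (simp add: vec_eq_iff forall_3)
    then show False using assms(3) by simp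
  qed
  then have w0: "w $ 1 \<noteq> 0" "w $ 3 \<noteq> 0" using w(2) ab by auto
  define g where "g = gcd (w $ 1) (w $ 3)"
  have g: "g > 0" using w0 by (simp add: g_def)
  obtain x y where xy: "w $ 1 = x * g" "w $ 3 = y * g" "coprime x y"
    using gcd_coprime_exists[of "w $ 1" "w $ 3"] g unfolding g_def by auto
  have "of_int x * a = of_int y * b"
    using w(2) g unfolding xy by simp
  then have "\<bar>of_int x * a\<bar> = \<bar>of_int y * b\<bar>" by simp
  then have eq: "of_int \<bar>x\<bar> * a = of_int \<bar>y\<bar> * b" using ab by (simp add: abs_mult)
  have "\<bar>x\<bar> > 0" "\<bar>y\<bar> > 0" using xy w0 by auto
  then have pos: "\<bar>x\<bar> \<ge> 1" "\<bar>y\<bar> \<ge> 1" "\<bar>x\<bar> + \<bar>y\<bar> \<ge> 1" by linarith+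
  define v :: "int^3" where "v = (\<chi> i. if i = 1 then - \<bar>x\<bar> else if i = 2 then \<bar>x\<bar> + \<bar>y\<bar> else - \<bar>y\<bar>)"
  have v: "v $ 1 = - \<bar>x\<bar>" "v $ 2 = \<bar>x\<bar> + \<bar>y\<bar>" "v $ 3 = - \<bar>y\<bar>" by (simp_all add: v_def)
  have sv: "is_cycle s v" using eq by (simp add: cyc balanced_def v)
  have gcd1: "Gcd A = 1" if "\<bar>x\<bar> \<in> A \<or> - \<bar>x\<bar> \<in> A" "\<bar>y\<bar> \<in> A \<or> - \<bar>y\<bar> \<in> A" for A :: "int set"
  proof -
    have "Gcd A dvd x" "Gcd A dvd y" using that Gcd_dvd[of _ A] by fastforce+
    then have "is_unit (Gcd A)" using xy(3) by (auto simp: coprime_def)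
    then show ?thesis by simp
  qed
  show ?thesis
  proof (cases "v $ 1 \<le> v $ 3")
    case True
    moreover have "Gcd {v $ 1, v $ 2, v $ 3} = 1" by (rule gcd1) (simp_all only: v insertI1 insert_iff simp_thms)
    ultimately have "v \<in> class_vectors"
      using pos by (simp add: class_vectors_def balanced_def v)
    then show ?thesis using sv by blast
  next
    case False
    moreover have "Gcd {v $ 3, v $ 2, v $ 1} = 1" by (rule gcd1) (simp_all only: v insertI1 insert_iff simp_thms)
    ultimately have "flip v \<in> class_vectors"
      using pos by (simp add: class_vectors_def balanced_def v)
    moreover have "is_cycle (flip_triple s) (flip v)"
      using sv by (simp add: is_cycle_flip_triple[OF assms(1)])
    ultimately show ?thesis by blast
  qed
qed

lemma class_vectors_neg:
  assumes "v \<in> class_vectors"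
  shows "v $ 1 < 0" "v $ 3 < 0" "v $ 1 \<le> v $ 3" "v $ 2 = - v $ 1 - v $ 3" "v \<noteq> 0" "balanced v"
  using assms by (auto simp: class_vectors_def balanced_def)

text \<open>The outer entries of two cycles are proportional. Coprime proportional pairs agree up to
  sign, and here the signs are negative.\<close>

lemma class_vector_unique:
  assumes "s \<in> K3" "v \<in> class_vectors" "v' \<in> class_vectors" "is_cycle s v" "is_cycle s v'"
  shows "v = v'"
proof -
  obtain a b :: real where ab: "a > 0" "b > 0"
    and cyc: "\<forall>v. is_cycle s v \<longleftrightarrow> balanced v \<and> of_int (v $ 1) * a = of_int (v $ 3) * b"
    using is_cycle_ratio[OF assms(1)] .
  have "of_int (v $ 1) * a = of_int (v $ 3) * b" "of_int (v' $ 1) * a = of_int (v' $ 3) * b"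
    using assms(4,5) cyc by auto
  then have "a * (of_int (v $ 1) * of_int (v' $ 3)) = a * (of_int (v $ 3) * of_int (v' $ 1))"
    by algebra
  then have "(of_int (v $ 1 * v' $ 3) :: real) = of_int (v $ 3 * v' $ 1)" using ab by simp
  then have eq: "v $ 1 * v' $ 3 = v $ 3 * v' $ 1" unfolding of_int_eq_iff .
  note cop = class_vectors_coprime[OF assms(2)] class_vectors_coprime[OF assms(3)]
  have "v $ 1 dvd v' $ 1"
  proof -
    have "v $ 1 dvd v $ 3 * v' $ 1" using eq by (metis dvd_triv_left)
    then show ?thesis using cop(1) by (simp add: coprime_dvd_mult_right_iff)
  qed
  moreover have "v' $ 1 dvd v $ 1"
  proof -
    have "v' $ 1 dvd v $ 1 * v' $ 3" using eq by (metis dvd_triv_right)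
    then show ?thesis using cop(2) by (simp add: coprime_dvd_mult_left_iff)
  qed
  ultimately have 1: "v $ 1 = v' $ 1"
    using class_vectors_neg(1)[OF assms(2)] class_vectors_neg(1)[OF assms(3)] zdvd_antisym_abs[of "v $ 1" "v' $ 1"]
    by simp
  then have 3: "v $ 3 = v' $ 3" using eq class_vectors_neg(1)[OF assms(3)] by simp
  show ?thesis
    using 1 3 class_vectors_neg(4)[OF assms(2)] class_vectors_neg(4)[OF assms(3)]
    by (simp add: vec_eq_iff forall_3)
qed

text \<open>The order of the outer entries of \<open>v\<close> gives \<open>a \<le> b\<close>, that
  of \<open>v'\<close> in the reversed triple \<open>b \<le> a\<close>. Hence the gaps are equal and
  \<open>v'\<close> is symmetric, which reduces the claim to
  \<open>class_vector_unique\<close>.\<close>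

lemma class_vector_unique_flip:
  assumes "s \<in> K3" "v \<in> class_vectors" "v' \<in> class_vectors" "is_cycle s v" "is_cycle (flip_triple s) v'"
  shows "v = v'"
proof -
  obtain a b :: real where ab: "a > 0" "b > 0"
    and cyc: "\<forall>v. is_cycle s v \<longleftrightarrow> balanced v \<and> of_int (v $ 1) * a = of_int (v $ 3) * b"
    using is_cycle_ratio[OF assms(1)] .
  have fl: "is_cycle s (flip v')" using assms(5) is_cycle_flip_triple[OF assms(1)] by blast
  have eq: "of_int (- v $ 1) * a = of_int (- v $ 3) * b" "of_int (- v' $ 3) * a = of_int (- v' $ 1) * b"
    using assms(4) fl cyc by auto
  note neg = class_vectors_neg(1-3)[OF assms(2)] class_vectors_neg(1-3)[OF assms(3)]
  have "of_int (- v' $ 3) * b \<le> of_int (- v' $ 3) * a"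
    unfolding eq(2) using neg ab by (intro mult_right_mono) auto
  moreover have "of_int (- v $ 3) * a \<le> of_int (- v $ 3) * b"
    unfolding eq(1)[symmetric] using neg ab by (intro mult_right_mono) auto
  ultimately have "a = b" using neg by (simp add: mult_le_cancel_left)
  then have "v' $ 1 = v' $ 3" using eq(2) ab by simp
  then have "flip v' = v'" by (simp add: vec_eq_iff forall_3)
  then show ?thesis using class_vector_unique[OF assms(1-4)] fl by simp
qed

section \<open>Isomorphism classes in terms of cycles\<close>

lemma cycle_sets_iff:
  assumes "s \<in> K3"
  shows "set_of s \<in> cycle_sets v \<longleftrightarrow> is_cycle s v \<or> is_cycle (flip_triple s) v"
proof
  assume "set_of s \<in> cycle_sets v"
  then obtain s' where "s' \<in> K3" "is_cycle s' v" "set_of s' = set_of s"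
    unfolding cycle_sets_def cycle_class_def by force
  \<comment> \<open>Another triple may have the same set; the identity is then an isomorphism, so
    its cycles are cycles of \<open>s\<close> or of the reversed triple.\<close>
  then show "is_cycle s v \<or> is_cycle (flip_triple s) v"
    using isomorphic_cycles[OF _ assms] betweenness_isomorphic_refl by metis
next
  assume "is_cycle s v \<or> is_cycle (flip_triple s) v"
  then have "s \<in> cycle_class v \<or> flip_triple s \<in> cycle_class v"
    using assms flip_triple_K3 by (auto simp: cycle_class_def)
  then show "set_of s \<in> cycle_sets v"
    unfolding cycle_sets_def using set_of_flip_triple by (metis image_eqI)
qed

lemma flip_0_iff [simp]: "flip v = 0 \<longleftrightarrow> v = (0 :: int^3)"
  by (auto simp: vec_eq_iff forall_3)

lemma trivial_cycles_transfer:
  assumes "s \<in> K3" "s' \<in> K3" "betweenness_isomorphic (set_of s) (set_of s')"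
    and "\<forall>v. is_cycle s' v \<longrightarrow> v = 0"
  shows "\<forall>v. is_cycle s v \<longrightarrow> v = 0"
  using isomorphic_cycles[OF assms(1-3)] is_cycle_flip_triple[OF assms(2)] assms(4) flip_0_iff by blast

lemma acyclic_sets_iff:
  assumes "s \<in> K3"
  shows "set_of s \<in> acyclic_sets \<longleftrightarrow> (\<forall>v. is_cycle s v \<longrightarrow> v = 0)"
proof
  assume "set_of s \<in> acyclic_sets"
  then obtain s' where "s' \<in> K3" "{v. is_cycle s' v} = {0}" "set_of s' = set_of s"
    unfolding acyclic_sets_def by force
  then show "\<forall>v. is_cycle s v \<longrightarrow> v = 0"
    using trivial_cycles_transfer[OF assms, of s'] betweenness_isomorphic_refl by (metis mem_Collect_eq singletonD)
next
  assume "\<forall>v. is_cycle s v \<longrightarrow> v = 0"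
  then have "{v. is_cycle s v} = {0}" using is_cycle_0[OF assms] by blast
  then show "set_of s \<in> acyclic_sets" unfolding acyclic_sets_def using assms by blast
qed

lemma betweenness_rel_Image_eqI:
  assumes "s \<in> K3" "X \<subseteq> set_of ` K3"
    and "\<And>s'. s' \<in> K3 \<Longrightarrow> set_of s' \<in> X \<longleftrightarrow> betweenness_isomorphic (set_of s) (set_of s')"
  shows "betweenness_rel `` {set_of s} = X"
  using assms unfolding betweenness_rel_def circles_with_three_points_eq by blast

lemma betweenness_class_cycle_sets:
  assumes "s \<in> K3" "v \<in> class_vectors" "set_of s \<in> cycle_sets v"
  shows "betweenness_rel `` {set_of s} = cycle_sets v"
proof (rule betweenness_rel_Image_eqI[OF assms(1)])
  show "cycle_sets v \<subseteq> set_of ` K3" by (auto simp: cycle_sets_def cycle_class_def)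
  obtain t where t: "t \<in> K3" "is_cycle t v" "set_of t = set_of s"
    using assms(3) unfolding cycle_sets_def cycle_class_def by force
  fix s' assume s': "s' \<in> K3"
  show "set_of s' \<in> cycle_sets v \<longleftrightarrow> betweenness_isomorphic (set_of s) (set_of s')"
  proof
    assume "set_of s' \<in> cycle_sets v"
    then obtain t' where t': "t' \<in> K3" "is_cycle t' v" "set_of t' = set_of s'"
      unfolding cycle_sets_def cycle_class_def by force
    show "betweenness_isomorphic (set_of s) (set_of s')"
      using isomorphic_if_common_cycle[OF t(1) t'(1) t(2) t'(2)] class_vectors_neg(2)[OF assms(2)] t(3) t'(3) by simp
  next
    assume "betweenness_isomorphic (set_of s) (set_of s')"
    then show "set_of s' \<in> cycle_sets v"
      using isomorphic_cycles[OF t(1) s'] t(2,3) cycle_sets_iff[OF s'] by simp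
  qed
qed

lemma betweenness_class_acyclic_sets:
  assumes "s \<in> K3" "set_of s \<in> acyclic_sets"
  shows "betweenness_rel `` {set_of s} = acyclic_sets"
proof (rule betweenness_rel_Image_eqI[OF assms(1)])
  show "acyclic_sets \<subseteq> set_of ` K3" by (auto simp: acyclic_sets_def)
  have s: "\<forall>v. is_cycle s v \<longrightarrow> v = 0" using assms acyclic_sets_iff by blast
  fix s' assume s': "s' \<in> K3"
  show "set_of s' \<in> acyclic_sets \<longleftrightarrow> betweenness_isomorphic (set_of s) (set_of s')"
    unfolding acyclic_sets_iff[OF s']
    using isomorphic_if_no_cycles[OF assms(1) s' s] trivial_cycles_transfer[OF s' assms(1) _ s]
      betweenness_isomorphic_sym by blast
qed

section \<open>Inhabitants of the classes\<close>

lemma cycle_sets_nonempty: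
  assumes "v \<in> class_vectors"
  obtains s where "s \<in> K3" "is_cycle s v"
proof -
  \<comment> \<open>The gaps are \<open>- v $ 3\<close> and \<open>- v $ 1\<close>: both positive,
    and in the ratio that \<open>v\<close> demands.\<close>
  define \<kappa> :: "3 \<Rightarrow> real" where
    "\<kappa> i = (if i = 1 then 0 else if i = 2 then - of_int (v $ 3) else - of_int (v $ 3) - of_int (v $ 1))" for i
  have "\<kappa> 1 < \<kappa> 2" "\<kappa> 2 < \<kappa> 3" using class_vectors_neg[OF assms] by (simp_all add: \<kappa>_def)
  then obtain s \<Gamma> where s: "s \<in> K3" "chart s \<kappa> \<Gamma>" using chart_realizable by blast
  have "dot v \<kappa> = 0"
    unfolding dot_3 class_vectors_neg(4)[OF assms] by (simp add: \<kappa>_def algebra_simps)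
  then have "is_cycle s v" using is_cycle_iff[OF s] class_vectors_neg(6)[OF assms] by simp
  then show thesis using that s(1) by blast
qed

lemma acyclic_sets_nonempty:
  obtains s where "s \<in> K3" "\<forall>v. is_cycle s v \<longrightarrow> v = 0"
proof -
  have "(\<rat> :: real set) \<noteq> UNIV" using countable_rat uncountable_UNIV_real by metis
  then obtain x0 :: real where "x0 \<notin> \<rat>" by blast
  define x where "x = \<bar>x0\<bar>"
  have "x0 \<noteq> 0" using \<open>x0 \<notin> \<rat>\<close> by auto
  then have x: "x \<notin> \<rat>" "x > 0"
    using \<open>x0 \<notin> \<rat>\<close> by (auto simp: x_def abs_if)
  \<comment> \<open>The gaps are 1 and the irrational number \<open>x\<close>, so no nonzero
    integral relation holds between them.\<close>
  define \<kappa> :: "3 \<Rightarrow> real" where "\<kappa> i = (if i = 1 then 0 else if i = 2 then 1 else 1 + x)" for i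
  have "\<kappa> 1 < \<kappa> 2" "\<kappa> 2 < \<kappa> 3" using x by (simp_all add: \<kappa>_def)
  then obtain s \<Gamma> where s: "s \<in> K3" "chart s \<kappa> \<Gamma>" using chart_realizable by blast
  have "v = 0" if "is_cycle s v" for v
  proof -
    have v: "balanced v" "of_int (v $ 2 + v $ 3) + of_int (v $ 3) * x = 0"
      using that is_cycle_iff[OF s] by (simp_all add: dot_3 \<kappa>_def algebra_simps)
    have "v $ 3 = 0"
    proof (rule ccontr)
      assume "v $ 3 \<noteq> 0"
      then have "x = - of_int (v $ 2 + v $ 3) / of_int (v $ 3)" using v(2) by (simp add: field_simps)
      then have "x \<in> \<rat>" by (metis Rats_divide Rats_minus_iff Rats_of_int)
      then show False using x by simp
    qed
    then show ?thesis using v by (simp add: balanced_def vec_eq_iff forall_3)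
  qed
  then show thesis using that s(1) by blast
qed

theorem theorem4p5:
  shows "circles_with_three_points // betweenness_rel =
           cycle_sets ` class_vectors \<union> {acyclic_sets} \<and>
         inj_on cycle_sets class_vectors \<and>
         (\<forall>v\<in>class_vectors. acyclic_sets \<noteq> cycle_sets v)"
proof (intro conjI)
  have cyc: "\<exists>s\<in>K3. is_cycle s v \<and> set_of s \<in> cycle_sets v" if "v \<in> class_vectors" for v
    using cycle_sets_nonempty[OF that] cycle_sets_iff by blast
  show "circles_with_three_points // betweenness_rel = cycle_sets ` class_vectors \<union> {acyclic_sets}" (is "?Q = ?R")
  proof
    show "?Q \<subseteq> ?R"
    proof
      fix X assume "X \<in> ?Q"
      then obtain s where s: "s \<in> K3" and X: "X = betweenness_rel `` {set_of s}"
        unfolding circles_with_three_points_eq quotient_def by blast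
      show "X \<in> ?R"
      proof (cases "\<forall>v. is_cycle s v \<longrightarrow> v = 0")
        case True
        then have "set_of s \<in> acyclic_sets" by (simp add: acyclic_sets_iff[OF s])
        then have "X = acyclic_sets" unfolding X by (rule betweenness_class_acyclic_sets[OF s])
        then show ?thesis by simp
      next
        case False
        then obtain v where v: "v \<in> class_vectors" "is_cycle s v \<or> is_cycle (flip_triple s) v"
          using nontrivial_cycle_class[OF s] by blast
        from v(2) have "set_of s \<in> cycle_sets v" by (simp only: cycle_sets_iff[OF s])
        then have "X = cycle_sets v" unfolding X by (rule betweenness_class_cycle_sets[OF s v(1)])
        then show ?thesis using v(1) by simp
      qed
    qed
    have Q: "betweenness_rel `` {set_of s} \<in> ?Q" if "s \<in> K3" for s
      using that unfolding circles_with_three_points_eq by (blast intro: quotientI)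
    show "?R \<subseteq> ?Q"
    proof
      fix X assume "X \<in> ?R"
      then consider v where "v \<in> class_vectors" "X = cycle_sets v" | "X = acyclic_sets" by blast
      then show "X \<in> ?Q"
      proof cases
        case 1
        then obtain s where "s \<in> K3" "set_of s \<in> cycle_sets v" using cyc by blast
        then have "betweenness_rel `` {set_of s} = X" "s \<in> K3"
          using betweenness_class_cycle_sets[OF _ 1(1)] 1(2) by simp_all
        then show ?thesis using Q[of s] by simp
      next
        case 2
        obtain s where "s \<in> K3" "\<forall>v. is_cycle s v \<longrightarrow> v = 0" using acyclic_sets_nonempty .
        then have "betweenness_rel `` {set_of s} = X" "s \<in> K3"
          using betweenness_class_acyclic_sets acyclic_sets_iff 2 by simp_all
        then show ?thesis using Q[of s] by simp
      qed
    qed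
  qed
  show "inj_on cycle_sets class_vectors"
  proof (rule inj_onI)
    fix v v' assume v: "v \<in> class_vectors" "v' \<in> class_vectors" and eq: "cycle_sets v = cycle_sets v'"
    obtain s where s: "s \<in> K3" "is_cycle s v" "set_of s \<in> cycle_sets v" using cyc[OF v(1)] by blast
    \<comment> \<open>The same \<open>s\<close> represents both classes, so \<open>v'\<close> is a
      cycle of \<open>s\<close> in one of its two orders; the normal form is unique in either
      case.\<close>
    then have "is_cycle s v' \<or> is_cycle (flip_triple s) v'" using eq cycle_sets_iff by blast
    then show "v = v'"
      using class_vector_unique[OF s(1) v s(2)] class_vector_unique_flip[OF s(1) v s(2)] by blast
  qed
  show "\<forall>v\<in>class_vectors. acyclic_sets \<noteq> cycle_sets v"
  proof
    fix v assume v: "v \<in> class_vectors"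
    obtain s where s: "s \<in> K3" "is_cycle s v" "set_of s \<in> cycle_sets v" using cyc[OF v] by blast
    then have "set_of s \<notin> acyclic_sets" using acyclic_sets_iff class_vectors_neg(5)[OF v] by blast
    then show "acyclic_sets \<noteq> cycle_sets v" using s(3) by blast
  qed
qed

end
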